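(* Let $\mathbb H$ be a Hilbert space and let $\phi\in\mathrm C^1(\mathbb H)$ satisfy, for some $\tau_*>0$ and $\phi_*\in\mathbb R$, $\frac1{2\tau_*}|x|^2+\phi(x)\ge-\phi_*$ for every $x\in\mathbb H$. With the notation of the context: (1) For every $R=\mathrm R[y]\subset\mathbb H$ which is the range of some $y\in\mathrm{GF}[\phi]$ there exists a unique $u\in\mathrm{GF}_{min}[\phi]$ such that $R\subset\mathrm R[u]\subset\overline R$. If $v\in\mathrm{GF}[\phi]$ and $R\subset\mathrm R[v]\subset\overline R$, then $v\succ u$. In particular, for every $v\in\mathrm{GF}[\phi]$ there exists a unique $u\in\mathrm{GF}_{min}[\phi]$ such that $v\succ u$. (2) Let $u\in\mathrm{GF}[\phi]$. Then $u\in\mathrm{GF}_{min}[\phi]$ if and only if for every $v\in\mathrm{TGF}[\phi]$ with $v(0)=u(0)$ and $\mathrm R[v]\subset\overline{\mathrm R[u]}$ the following holds: if $u(t_0)=v(t_1)$ for some $t_0,t_1\ge0$, then $t_0\wedge T_\star(u)\le t_1$. (3) Let $u\in\mathrm{GF}[\phi]$. Then $u\in\mathrm{GF}_{min}[\phi]$ if and only if for every $v\in\mathrm{TGF}[\phi]$ with $v(0)=u(0)$ and $\mathrm R[v]\subset\overline{\mathrm R[u]}$ we have $\phi(v(t))\ge\phi(u(t))$ for every $t\ge0$. (4) If $u\in\mathrm{GF}_{min}[\phi]$, $v\in\mathrm{TGF}[\phi]$ with $v(0)=u(0)$, $\mathrm R[v]\subset\mathrm R[u]$ and $\phi(v(t))\le\phi(u(t))$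 for every $t\in[0,T_\star(v))$, then $v(t)=u(t)$ for every $t\in[0,T_\star(v))$. (5) Let $u\in\mathrm{GF}[\phi]$. Then $u\in\mathrm{GF}_{min}[\phi]$ if and only if $$\mathscr L^1\big(\{t\in[0,T_\star(u)):\nabla\phi(u(t))=0\}\big)=0 .$$ If $u\in\mathrm{GF}_{min}[\phi]$ and $T_\star(u)>0$, the map $t\mapsto\phi(u(t))$ is strictly decreasing in $[0,T_\star(u))$ and the map $t\mapsto u(t)$ is injective in $[0,T_\star(u))$. (6) A non-constant solution $u\in\mathrm{GF}[\phi]$ is minimal if and only if there exists a locally absolutely continuous map $\psi:\big(\inf_{\mathrm R[u]}\phi,\phi(u(0))\big]\to[0,T_\star(u))$ such that $t=\psi(\phi(u(t)))$ for every $t\in[0,T_\star(u))$.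
   Context: $\mathrm{GF}[\phi]$ is the set of all $u\in\mathrm C^1([0,+\infty);\mathbb H)$ with $u'(t)=-\nabla\phi(u(t))$ for all $t\ge0$. $\mathrm{TGF}[\phi]\supset\mathrm{GF}[\phi]$ (truncated solutions) consists of all elements of $\mathrm{GF}[\phi]$ together with all curves $v:[0,\infty)\to\mathbb H$ of the form $v(t)=\tilde v(t\wedge T)$ for some $\tilde v\in\mathrm{GF}[\phi]$ and $T\in[0,\infty)$. $\mathrm R[u]:=u([0,\infty))$ is the range of $u$. $T_\star(u):=\inf\{t\in[0,+\infty):u(s)=u(t)\ \text{for every }s\ge t\}$, with $T_\star(u)=+\infty$ if this set is empty. $\mathscr L^1$ is Lebesgue measure. For $u,v\in\mathrm{GF}[\phi]$ we write $u\succ v$ if $\mathrm R[v]\subset\overline{\mathrm R[u]}$ and there exists a map $\mathsf z:[0,+\infty)\to[0,+\infty)$ with $\mathsf z(0)=0$, $0\le\mathsf z(t)-\mathsf z(s)\le t-s$ for every $0\le s\le t$, and $u(t)=v(\mathsf z(t))$ for every $t\ge0$. An element $u\in\mathrm{GF}[\phi]$ is minimal if for every $v\in\mathrm{GF}[\phi]$, $u\succ v$ implies $u=v$; $\mathrm{GF}_{min}[\phi]$ is the set of minimal solutions. *)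

theory Defs
  imports "HOL-Analysis.Analysis"
begin

text \<open>
  A real Hilbert space is a type of sort \<open>{real_inner, complete_space}\<close>. Curves
  \<open>[0, +\<infinity>) \<rightarrow> \<H>\<close> are total functions on \<open>real\<close> that are \<open>extensional\<close> on \<open>{0..}\<close>, so that
  HOL equality of such functions is equality of curves.
\<close>

text \<open>Continuity of the differential refers to the operator norm.\<close>

definition C1_functional :: "('a::real_normed_vector \<Rightarrow> real) \<Rightarrow> bool" where
  "C1_functional \<phi> \<longleftrightarrow>
     (\<exists>\<phi>'. (\<forall>x. (\<phi> has_derivative blinfun_apply (\<phi>' x)) (at x)) \<and> continuous_on UNIV \<phi>')"

text \<open>
  On a Hilbert space the gradient exists wherever \<open>\<phi>\<close> is Frechet differentiable, and it is
  always unique.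
\<close>

definition grad :: "('a::real_inner \<Rightarrow> real) \<Rightarrow> 'a \<Rightarrow> 'a" where
  "grad \<phi> x = (THE g. GDERIV \<phi> x :> g)"

definition GF :: "('a::real_inner \<Rightarrow> real) \<Rightarrow> (real \<Rightarrow> 'a) set" where
  "GF \<phi> = {u \<in> extensional {0..}.
     \<exists>u'. continuous_on {0..} u' \<and>
       (\<forall>t\<ge>0. (u has_vector_derivative u' t) (at t within {0..}) \<and> u' t = - grad \<phi> (u t))}"

definition TGF :: "('a::real_inner \<Rightarrow> real) \<Rightarrow> (real \<Rightarrow> 'a) set" where
  "TGF \<phi> = GF \<phi> \<union> {restrict (\<lambda>t. w (min t T)) {0..} | w T. w \<in> GF \<phi> \<and> 0 \<le> T}"

definition Rg :: "(real \<Rightarrow> 'a) \<Rightarrow> 'a set" where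
  "Rg u = u ` {0..}"

text \<open>In \<open>ereal\<close> the infimum of the empty set is \<open>\<infinity>\<close>.\<close>

definition T_star :: "(real \<Rightarrow> 'a) \<Rightarrow> ereal" where
  "T_star u = Inf (ereal ` {t. 0 \<le> t \<and> (\<forall>s\<ge>t. u s = u t)})"

definition succeeds :: "(real \<Rightarrow> 'a::topological_space) \<Rightarrow> (real \<Rightarrow> 'a) \<Rightarrow> bool"
    (infix \<open>\<succ>\<close> 50) where
  "u \<succ> v \<longleftrightarrow> Rg v \<subseteq> closure (Rg u) \<and>
     (\<exists>z. z \<in> {0..} \<rightarrow> {0..} \<and> z 0 = 0 \<and>
       (\<forall>s t. 0 \<le> s \<and> s \<le> t \<longrightarrow> 0 \<le> z t - z s \<and> z t - z s \<le> t - s) \<and>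
       (\<forall>t\<ge>0. u t = v (z t)))"

definition GF_min :: "('a::real_inner \<Rightarrow> real) \<Rightarrow> (real \<Rightarrow> 'a) set" where
  "GF_min \<phi> = {u \<in> GF \<phi>. \<forall>v\<in>GF \<phi>. u \<succ> v \<longrightarrow> u = v}"

text \<open>
  The usual \<open>\<epsilon>\<close>-\<open>\<delta>\<close> definition; a pair \<open>(x, y) \<in> P\<close> stands for the open interval from \<open>x\<close> to \<open>y\<close>.
\<close>

definition abs_cont_on :: "real \<Rightarrow> real \<Rightarrow> (real \<Rightarrow> real) \<Rightarrow> bool" where
  "abs_cont_on a b f \<longleftrightarrow>
     (\<forall>\<epsilon>>0. \<exists>\<delta>>0. \<forall>P :: (real \<times> real) set.
        finite P \<and> (\<forall>(x, y)\<in>P. a \<le> x \<and> x \<le> y \<and> y \<le> b) \<and>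
        disjoint_family_on (\<lambda>(x, y). {x<..<y}) P \<and> (\<Sum>(x, y)\<in>P. y - x) < \<delta> \<longrightarrow>
        (\<Sum>(x, y)\<in>P. \<bar>f y - f x\<bar>) < \<epsilon>)"

definition loc_abs_cont_on :: "real set \<Rightarrow> (real \<Rightarrow> real) \<Rightarrow> bool" where
  "loc_abs_cont_on I f \<longleftrightarrow> (\<forall>a b. a \<le> b \<and> {a..b} \<subseteq> I \<longrightarrow> abs_cont_on a b f)"

end

theory Submission
  imports Defs
begin

text \<open>
  Along a gradient flow the energy decreases at rate \<open>(norm (grad \<phi> (u t)))\<^sup>2\<close>, so a solution can
  pause only at critical points, and apart from pauses it runs through the points of its range in
  order of decreasing energy. Two solutions with the same starting point and the same range
  therefore differ only by the time that they idle at critical points. The quantity that makes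
  this precise is the \<^emph>\<open>active time\<close> \<open>s\<^sub>u t\<close>, the Lebesgue measure of the set of those
  times in \<open>{0..t}\<close> at which the gradient does not vanish.

  The central fact is that active time is intrinsic: if \<open>u\<close> and \<open>v\<close> start at the same point,
  \<open>u a = v b\<close>, and \<open>v\<close> stays in \<open>u ` {0..a}\<close> until \<open>b\<close>, then \<open>s\<^sub>u a = s\<^sub>v b\<close>
  (\<open>active_time_intrinsic\<close>). Formally both sides are the integral of \<open>1 / (norm (grad \<phi>))\<^sup>2\<close> with
  respect to the energy level. As this density is singular at critical points, the indicator of
  non-critical times is written as the increasing limit of the continuous functions
  \<open>n * q / (1 + n * q)\<close> with \<open>q = (norm (grad \<phi> (u t)))\<^sup>2\<close>; for these the substitution of the
  energy level as integration variable is elementary calculus, and the estimates for active time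
  follow by letting \<open>n\<close> tend to infinity.

  Since \<open>s\<^sub>v b \<le> b\<close>, the number \<open>s\<^sub>u a\<close> bounds from below the time in which any solution can
  reach \<open>u a\<close> along this trace. Call \<open>u\<close> \<^emph>\<open>tight\<close> if \<open>s\<^sub>u t = t\<close> up to \<open>T_star u\<close>; such a
  solution reaches every point as early as possible. Any solution \<open>y\<close> factors as
  \<open>y = w \<circ> s\<^sub>y\<close>, where \<open>w = reduced y\<close> is tight and \<open>y \<succ> w\<close>. If the total active time
  of \<open>y\<close> is finite, the lower bound on \<open>\<phi>\<close> forces \<open>y\<close> to converge to a critical point
  (\<open>flow_converges_if_active_time_bounded\<close>), and \<open>w\<close> rests there afterwards; this is the reason
  for the closure of the range in the statement.

  It follows that minimal means tight (\<open>minimal_iff_tight\<close>): a minimal \<open>u\<close> equals \<open>reduced u\<close>, and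
  a tight \<open>u\<close> leaves no room for a slower clock \<open>z\<close>, because \<open>s\<^sub>u t \<le> z t \<le> t\<close>. The six
  parts are then consequences. Existence in (1) is \<open>reduced y\<close>. Parts (2) and (3) hold for tight
  solutions by earliest arrival, and the competitor \<open>reduced u\<close> gives the converses. Uniqueness in
  (1) and part (4) follow from (3), because points of the closure of the range are determined by
  their energy as soon as \<open>u\<close> attains this energy. In (5) the measure of the critical times before
  \<open>t\<close> is \<open>t - s\<^sub>u t\<close>. In (6), approximate active time is a Lipschitz function of the energy and
  exhausts the time of a tight solution, which makes the inverse absolutely continuous;
  conversely, energy is almost constant near critical times, so an absolutely continuous inverse
  cannot assign positive measure to them.
\<close>

section \<open>The gradient on a Hilbert space\<close>

text \<open>
  A minimising sequence of \<open>(norm x)\<^sup>2 - 2 * f x\<close> is Cauchy by the parallelogram law, and its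
  limit represents \<open>f\<close> because the first variation vanishes there.
\<close>

lemma riesz_representation:
  fixes f :: "'a::{real_inner, complete_space} \<Rightarrow> real"
  assumes "bounded_linear f"
  obtains d where "\<And>h. f h = inner h d"
proof -
  interpret f: bounded_linear f by fact
  define J where "J x = (norm x)\<^sup>2 - 2 * f x" for x
  obtain K where K: "\<And>x. norm (f x) \<le> norm x * K"
    using f.bounded by blast
  have J_ge: "- K\<^sup>2 \<le> J x" for x
  proof -
    have "f x \<le> norm x * K" using K[of x] by simp
    moreover have "0 \<le> (norm x - K)\<^sup>2" by simp
    ultimately show ?thesis by (simp add: J_def power2_eq_square algebra_simps)
  qed
  define m where "m = Inf (range J)"
  have bdd: "bdd_below (range J)" using J_ge by (auto simp: bdd_below_def)
  have m_le: "m \<le> J x" for x unfolding m_def by (rule cInf_lower[OF _ bdd]) auto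
  have "\<exists>x. J x < m + 1 / real (Suc n)" for n
    using cInf_lessD[of "range J" "m + 1 / real (Suc n)"] by (auto simp: m_def)
  then obtain x where x: "\<And>n. J (x n) < m + 1 / real (Suc n)" by metis
  \<comment> \<open>the parallelogram law; \<open>f\<close> drops out because it is linear\<close>
  have mid: "(norm (y - z))\<^sup>2 = 2 * J y + 2 * J z - 4 * J ((1/2) *\<^sub>R (y + z))" for y z
    by (simp add: J_def f.add f.scaleR power2_norm_eq_inner inner_add inner_diff inner_commute
        algebra_simps)
  have gap: "(norm (x i - x j))\<^sup>2 \<le> 2 / real (Suc i) + 2 / real (Suc j)" for i j
    using mid[of "x i" "x j"] x[of i] x[of j] m_le[of "(1/2) *\<^sub>R (x i + x j)"] by simp
  have "Cauchy x"
  proof (rule CauchyI)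
    fix e :: real assume "0 < e"
    then obtain N where N: "inverse (real (Suc N)) < e\<^sup>2 / 4"
      using reals_Archimedean[of "e\<^sup>2 / 4"] by auto
    have "norm (x i - x j) < e" if "i \<ge> N" "j \<ge> N" for i j
    proof -
      have "2 / real (Suc i) \<le> 2 * inverse (real (Suc N))" "2 / real (Suc j) \<le> 2 * inverse (real (Suc N))"
        using that by (auto simp: field_simps)
      with gap[of i j] N have "(norm (x i - x j))\<^sup>2 < e\<^sup>2" by linarith
      with \<open>0 < e\<close> show ?thesis by (simp add: power2_less_imp_less)
    qed
    then show "\<exists>M. \<forall>i\<ge>M. \<forall>j\<ge>M. norm (x i - x j) < e" by blast
  qed
  then obtain d where d: "x \<longlonglongrightarrow> d" using Cauchy_convergent_iff convergent_def by blast
  have "(\<lambda>n. J (x n)) \<longlonglongrightarrow> J d" unfolding J_def by (intro tendsto_intros d f.tendsto)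
  moreover have "(\<lambda>n. m + 1 / real (Suc n)) \<longlonglongrightarrow> m + 0"
    by (intro tendsto_intros LIMSEQ_Suc lim_1_over_n)
  ultimately have "J d \<le> m + 0"
    by (rule LIMSEQ_le) (use x in \<open>auto intro!: exI[of _ 0] less_imp_le\<close>)
  then have min: "J d \<le> J y" for y using m_le[of y] by simp
  have "f h = inner h d" for h
  proof (cases "h = 0")
    case True then show ?thesis by simp
  next
    case False
    define a where "a = inner h d - f h"
    \<comment> \<open>the minimiser of the quadratic polynomial \<open>t \<mapsto> J (d + t *\<^sub>R h)\<close>\<close>
    define t where "t = - a / (norm h)\<^sup>2"
    have "J (d + t *\<^sub>R h) = J d + 2 * t * a + t\<^sup>2 * (norm h)\<^sup>2"
      unfolding J_def a_def f.add f.scaleR power2_norm_eq_inner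
      by (simp add: inner_add inner_commute algebra_simps power2_eq_square)
    then have "0 \<le> 2 * t * a + t\<^sup>2 * (norm h)\<^sup>2" using min[of "d + t *\<^sub>R h"] by simp
    also have "\<dots> = - (a\<^sup>2 / (norm h)\<^sup>2)"
      using False by (simp add: t_def power2_eq_square field_simps)
    finally have "a = 0" using False by (simp add: divide_le_0_iff)
    then show ?thesis by (simp add: a_def)
  qed
  then show ?thesis by (rule that)
qed

lemma gderiv_unique:
  assumes "GDERIV f x :> d" "GDERIV f x :> e"
  shows "d = e"
proof -
  have "(\<lambda>h. inner h d) = (\<lambda>h. inner h e)"
    using assms unfolding gderiv_def by (rule has_derivative_unique)
  then show ?thesis by (metis inner_commute vector_eq_rdot)
qed

text \<open>
  By the Riesz representation the gradient exists, and the distance of two gradients is at most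
  the operator norm of the difference of the two derivatives; hence it is continuous.
\<close>

lemma C1_functional_grad:
  fixes \<phi> :: "'a::{real_inner, complete_space} \<Rightarrow> real"
  assumes "C1_functional \<phi>"
  shows "GDERIV \<phi> x :> grad \<phi> x" and "continuous_on UNIV (grad \<phi>)"
proof -
  obtain D where D: "\<And>x. (\<phi> has_derivative blinfun_apply (D x)) (at x)" "continuous_on UNIV D"
    using assms unfolding C1_functional_def by blast
  have ex: "GDERIV \<phi> x :> grad \<phi> x" for x
  proof -
    obtain d where "\<And>h. blinfun_apply (D x) h = inner h d"
      using riesz_representation[OF blinfun.bounded_linear_right[of "D x"]] by blast
    then have "blinfun_apply (D x) = (\<lambda>h. inner h d)" by auto
    then have "GDERIV \<phi> x :> d" using D(1)[of x] by (simp add: gderiv_def)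
    then show ?thesis unfolding grad_def by (rule theI) (use \<open>GDERIV \<phi> x :> d\<close> gderiv_unique in blast)
  qed
  then show "GDERIV \<phi> x :> grad \<phi> x" .
  have app: "blinfun_apply (D x) h = inner h (grad \<phi> x)" for x h
    using has_derivative_unique[OF D(1)[of x] ex[of x, unfolded gderiv_def]] by metis
  have le: "norm (grad \<phi> x - grad \<phi> y) \<le> norm (D x - D y)" for x y
  proof -
    let ?h = "grad \<phi> x - grad \<phi> y"
    have "(norm ?h)\<^sup>2 = blinfun_apply (D x - D y) ?h"
      by (simp add: power2_norm_eq_inner blinfun.diff_left app inner_diff_right)
    also have "\<dots> \<le> norm (D x - D y) * norm ?h"
      using norm_blinfun[of "D x - D y" ?h] by (simp add: abs_le_iff)
    finally show ?thesis
      by (cases "?h = 0") (simp_all add: power2_eq_square)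
  qed
  show "continuous_on UNIV (grad \<phi>)"
    unfolding continuous_on_iff
  proof (intro ballI allI impI)
    fix x :: 'a and e :: real assume "0 < e"
    then obtain r where "r > 0" "\<And>y. dist y x < r \<Longrightarrow> dist (D y) (D x) < e"
      using D(2) unfolding continuous_on_iff by (metis UNIV_I)
    then show "\<exists>d>0. \<forall>y\<in>UNIV. dist y x < d \<longrightarrow> dist (grad \<phi> y) (grad \<phi> x) < e"
      using le by (metis dist_norm order_le_less_trans)
  qed
qed

section \<open>Stationary tails of curves, and sums of increments\<close>

lemma T_star_nonneg: "0 \<le> T_star u"
  unfolding T_star_def by (rule Inf_greatest) auto

text \<open>
  Continuity makes the infimum that defines \<open>T_star\<close> a minimum.
\<close>

lemma T_star_le_iff:
  fixes u :: "real \<Rightarrow> 'b::t2_space"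
  assumes cont: "continuous_on {0..} u" and t: "0 \<le> t"
  shows "T_star u \<le> ereal t \<longleftrightarrow> (\<forall>s\<ge>t. u s = u t)"
proof
  assume "\<forall>s\<ge>t. u s = u t"
  then have "ereal t \<in> ereal ` {t. 0 \<le> t \<and> (\<forall>s\<ge>t. u s = u t)}" using t by blast
  then show "T_star u \<le> ereal t" unfolding T_star_def by (rule Inf_lower)
next
  assume le: "T_star u \<le> ereal t"
  have late: "u s = u r" if "t < r" "r \<le> s" for r s
  proof -
    have "T_star u < ereal r" using le_less_trans[OF le, of "ereal r"] that by simp
    then obtain y where y: "y \<in> ereal ` {t. 0 \<le> t \<and> (\<forall>s\<ge>t. u s = u t)}" "y < ereal r"
      unfolding T_star_def Inf_less_iff by blast
    from y(1) obtain T where "y = ereal T" and T: "\<forall>s\<ge>T. u s = u T" by blast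
    then have "T < r" using y(2) by simp
    then have "u s = u T" "u r = u T" using T[rule_format, of s] T[rule_format, of r] that by auto
    then show ?thesis by simp
  qed
  show "\<forall>s\<ge>t. u s = u t"
  proof (intro allI impI)
    fix s assume "t \<le> s"
    show "u s = u t"
    proof (cases "t = s")
      case False
      with \<open>t \<le> s\<close> have "t < s" by simp
      have "(u \<longlongrightarrow> u t) (at t within {0..})" using cont t by (simp add: continuous_on_def)
      then have "(u \<longlongrightarrow> u t) (at_right t)" by (rule tendsto_within_subset) (use t in auto)
      moreover have "eventually (\<lambda>r. u r = u s) (at_right t)"
        unfolding eventually_at_right_field using late[of _ s] \<open>t < s\<close> by (intro exI[of _ s]) auto
      then have "(u \<longlongrightarrow> u s) (at_right t)" by (rule tendsto_eventually)
      ultimately show ?thesis using tendsto_unique trivial_limit_at_right_real by blast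
    qed simp
  qed
qed

text \<open>
  Induction removes the interval with the largest right end point \<open>y\<close>; by disjointness all others
  lie to the left of its left end point \<open>x\<close>, so that the induction hypothesis applies on
  \<open>{a..x}\<close>. Degenerate pairs \<open>(x, x)\<close> may lie inside other intervals, but they contribute nothing
  and are discarded at the start.
\<close>

lemma sum_increments_disjoint_le:
  fixes k :: "real \<Rightarrow> real"
  assumes P: "finite P" "\<And>x y. (x, y) \<in> P \<Longrightarrow> a \<le> x \<and> x \<le> y \<and> y \<le> b"
    and disj: "disjoint_family_on (\<lambda>(x, y). {x<..<y}) P"
    and ab: "a \<le> b" and mono: "mono_on {a..b} k"
  shows "(\<Sum>(x, y)\<in>P. k y - k x) \<le> k b - k a"
proof -
  have main: "(\<Sum>(x, y)\<in>Q. k y - k x) \<le> k c - k a"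
    if "finite Q" "\<And>x y. (x, y) \<in> Q \<Longrightarrow> a \<le> x \<and> x < y \<and> y \<le> c"
      "disjoint_family_on (\<lambda>(x, y). {x<..<y}) Q" "a \<le> c" "c \<le> b" for Q c
    using that
  proof (induction Q arbitrary: c rule: finite_ranking_induct[where f = snd])
    case empty
    then show ?case using mono by (auto intro!: mono_onD[OF mono])
  next
    case (insert p Q)
    obtain x y where p: "p = (x, y)" by (cases p)
    have xy: "a \<le> x" "x < y" "y \<le> c" using insert.prems(1)[of x y] p by auto
    show ?case
    proof (cases "p \<in> Q")
      case True
      then show ?thesis using insert.IH[of c] insert.prems by (simp add: insert_absorb)
    next
      case False
      have "(\<Sum>(x, y)\<in>Q. k y - k x) \<le> k x - k a"
      proof (rule insert.IH)
        fix x' y' assume q: "(x', y') \<in> Q"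
        have xy': "a \<le> x'" "x' < y'" "y' \<le> y" using insert.prems(1)[of x' y'] insert.hyps(2)[OF q] q p by auto
        have "(x', y') \<noteq> (x, y)" using q False p by auto
        then have "{x'<..<y'} \<inter> {x<..<y} = {}"
          using disjoint_family_onD[OF insert.prems(2), of "(x', y')" "(x, y)"] q p by auto
        then have "max x x' \<ge> y'" using dense[of "max x x'" y'] xy xy' by fastforce
        then show "a \<le> x' \<and> x' < y' \<and> y' \<le> x" using xy' by (auto simp: max_def split: if_splits)
      qed (use insert.prems xy in \<open>auto simp: disjoint_family_on_def\<close>)
      moreover have "k y \<le> k c" using xy insert.prems by (intro mono_onD[OF mono]) auto
      ultimately show ?thesis using insert.hyps False p by simp
    qed
  qed
  let ?Q = "{p \<in> P. fst p < snd p}"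
  have "(\<Sum>(x, y)\<in>P. k y - k x) = (\<Sum>(x, y)\<in>?Q. k y - k x)"
  proof (intro sum.mono_neutral_right ballI)
    fix p assume "p \<in> P - ?Q"
    then have "fst p = snd p" using P(2)[of "fst p" "snd p"] by auto
    then show "(case p of (x, y) \<Rightarrow> k y - k x) = 0" by (simp add: case_prod_beta)
  qed (use P in auto)
  also have "\<dots> \<le> k b - k a"
    by (rule main) (use P disj ab in \<open>auto simp: disjoint_family_on_def\<close>)
  finally show ?thesis .
qed

section \<open>Active time along a gradient flow\<close>

locale C1_energy =
  fixes \<phi> :: "'a::{real_inner, complete_space} \<Rightarrow> real" and g :: "'a \<Rightarrow> 'a"
  assumes gderiv: "GDERIV \<phi> x :> g x" and cont_g: "continuous_on UNIV g"
begin

text \<open>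
  Curves are considered here without the extensionality that membership in \<open>GF\<close> demands.
\<close>

definition flow :: "(real \<Rightarrow> 'a) \<Rightarrow> bool" where
  "flow u \<longleftrightarrow> (\<forall>t\<ge>0. (u has_vector_derivative - g (u t)) (at t within {0..}))"

lemma continuous_on_\<phi>: "continuous_on A \<phi>"
  using gderiv by (meson continuous_at_imp_continuous_on gderiv_def has_derivative_continuous)

lemma continuous_on_g: "continuous_on A g"
  using cont_g continuous_on_subset by blast

lemma flowD:
  assumes "flow u" "t \<ge> 0"
  shows "(u has_vector_derivative - g (u t)) (at t within {0..})"
  using assms by (auto simp: flow_def)

lemma flow_deriv_interior:
  assumes "flow u" "t > 0"
  shows "(u has_vector_derivative - g (u t)) (at t)"
  using flowD[OF assms(1), of t] assms(2) at_within_interior[of t "{0..}"] by simp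

lemma flow_continuous: "flow u \<Longrightarrow> A \<subseteq> {0..} \<Longrightarrow> continuous_on A u"
  by (rule continuous_on_subset[of "{0..}"])
    (auto simp: continuous_on_eq_continuous_within intro: has_vector_derivative_continuous flowD)

lemma energy_deriv:
  assumes "flow u" "t \<ge> 0"
  shows "((\<lambda>t. \<phi> (u t)) has_real_derivative - (norm (g (u t)))\<^sup>2) (at t within {0..})"
proof -
  have "((\<lambda>t. \<phi> (u t)) has_derivative (\<lambda>h. inner (h *\<^sub>R - g (u t)) (g (u t)))) (at t within {0..})"
    using flowD[OF assms] gderiv[of "u t"] has_derivative_compose
    unfolding has_vector_derivative_def gderiv_def by blast
  moreover have "(\<lambda>h. inner (h *\<^sub>R - g (u t)) (g (u t))) = (*) (- (norm (g (u t)))\<^sup>2)"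
    by (auto simp: power2_norm_eq_inner)
  ultimately show ?thesis by (simp add: has_field_derivative_def)
qed

lemma energy_deriv_interior:
  assumes "flow u" "t > 0"
  shows "((\<lambda>t. \<phi> (u t)) has_real_derivative - (norm (g (u t)))\<^sup>2) (at t)"
  using energy_deriv[OF assms(1), of t] assms(2) at_within_interior[of t "{0..}"] by simp

lemma energy_continuous: "flow u \<Longrightarrow> A \<subseteq> {0..} \<Longrightarrow> continuous_on A (\<lambda>t. \<phi> (u t))"
  using continuous_on_compose2[OF continuous_on_\<phi>[of UNIV] flow_continuous] by auto

text \<open>
  A bounded continuous substitute for \<open>1 / (norm (g x))\<^sup>2\<close>, the derivative of active time with
  respect to decreasing energy.
\<close>

definition level_weight :: "nat \<Rightarrow> 'a \<Rightarrow> real" where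
  "level_weight n x = n / (1 + n * (norm (g x))\<^sup>2)"

text \<open>
  These are continuous functions on the Hilbert space that increase with \<open>n\<close> to the indicator
  function of the non-critical points.
\<close>

definition activity :: "nat \<Rightarrow> 'a \<Rightarrow> real" where
  "activity n x = level_weight n x * (norm (g x))\<^sup>2"

definition smooth_time :: "nat \<Rightarrow> (real \<Rightarrow> 'a) \<Rightarrow> real \<Rightarrow> real" where
  "smooth_time n u t = integral {0..t} (\<lambda>r. activity n (u r))"

definition active_time :: "(real \<Rightarrow> 'a) \<Rightarrow> real \<Rightarrow> real" where
  "active_time u t = integral {0..t} (\<lambda>r. of_bool (g (u r) \<noteq> 0))"

lemma activity_denom_pos: "0 < 1 + real n * (norm (g x))\<^sup>2"
  by (simp add: add_pos_nonneg)

lemma continuous_on_level_weight: "continuous_on A (level_weight n)"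
  unfolding level_weight_def
  by (intro continuous_intros continuous_on_g) (use activity_denom_pos[of n] in \<open>auto simp: less_imp_neq[symmetric]\<close>)

lemma continuous_on_activity: "continuous_on A (activity n)"
  unfolding activity_def by (intro continuous_intros continuous_on_g continuous_on_level_weight)

lemma level_weight_bounds: "0 \<le> level_weight n x" "level_weight n x \<le> n"
proof -
  show "0 \<le> level_weight n x" unfolding level_weight_def using activity_denom_pos[of n x] by simp
  have "real n * 1 \<le> real n * (1 + n * (norm (g x))\<^sup>2)" by (intro mult_left_mono) auto
  then show "level_weight n x \<le> n" unfolding level_weight_def using activity_denom_pos[of n x]
    by (simp add: divide_le_eq)
qed

lemma one_minus_activity: "1 - activity n x = 1 / (1 + n * (norm (g x))\<^sup>2)"
  unfolding activity_def level_weight_def using activity_denom_pos[of n x] by (simp add: field_simps)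

lemma activity_bounds: "0 \<le> activity n x" "activity n x \<le> 1"
proof -
  show "0 \<le> activity n x" unfolding activity_def using level_weight_bounds(1) by simp
  have "0 \<le> 1 - activity n x" unfolding one_minus_activity using activity_denom_pos[of n x] by simp
  then show "activity n x \<le> 1" by simp
qed

text \<open>
  Where \<open>activity n\<close> is far from \<open>1\<close> the flow is slow: the part of the velocity that it misses is
  uniformly small. This makes the motion during the neglected time vanish in the limit.
\<close>

lemma one_minus_activity_speed:
  assumes "n > 0"
  shows "(1 - activity n x) * norm (g x) \<le> 1 / sqrt n"
proof -
  have "0 \<le> (sqrt n * norm (g x) - 1)\<^sup>2 + 1 * (sqrt n * norm (g x))"
    by (intro add_nonneg_nonneg) auto
  then have "sqrt n * norm (g x) \<le> 1 + n * (norm (g x))\<^sup>2"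
    by (simp add: power2_diff power_mult_distrib)
  then have "norm (g x) * sqrt n \<le> 1 * (1 + n * (norm (g x))\<^sup>2)" by (simp add: mult.commute)
  then have "norm (g x) / (1 + n * (norm (g x))\<^sup>2) \<le> 1 / sqrt n"
    using activity_denom_pos[of n x] assms by (subst frac_le_eq) (auto simp: divide_le_0_iff)
  then show ?thesis by (simp add: one_minus_activity)
qed

lemma activity_mono: "activity n x \<le> activity (Suc n) x"
proof -
  have "1 / (1 + Suc n * (norm (g x))\<^sup>2) \<le> 1 / (1 + n * (norm (g x))\<^sup>2)"
    using activity_denom_pos[of n x] activity_denom_pos[of "Suc n" x]
    by (intro divide_left_mono mult_pos_pos) (auto simp: algebra_simps)
  then have "1 - activity (Suc n) x \<le> 1 - activity n x" by (simp only: one_minus_activity)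
  then show ?thesis by simp
qed

lemma activity_tendsto: "(\<lambda>n. activity n x) \<longlonglongrightarrow> of_bool (g x \<noteq> 0)"
proof (cases "g x = 0")
  case True then show ?thesis by (simp add: activity_def)
next
  case False
  have "filterlim (\<lambda>n. 1 + real n * (norm (g x))\<^sup>2) at_top sequentially"
    using False
    by (intro filterlim_tendsto_add_at_top[OF tendsto_const]
        filterlim_at_top_mult_tendsto_pos[OF tendsto_const] filterlim_real_sequentially) auto
  then have "(\<lambda>n. 1 / (1 + real n * (norm (g x))\<^sup>2)) \<longlonglongrightarrow> 0"
    by (intro tendsto_divide_0[OF tendsto_const] filterlim_at_top_imp_at_infinity)
  then have "(\<lambda>n. 1 - activity n x) \<longlonglongrightarrow> 0" by (simp only: one_minus_activity)
  then have "(\<lambda>n. 1 - (1 - activity n x)) \<longlonglongrightarrow> 1 - 0" by (intro tendsto_intros)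
  then show ?thesis using False by simp
qed

context
  fixes u assumes flow: "flow u"
begin

lemma continuous_on_activity_flow: "A \<subseteq> {0..} \<Longrightarrow> continuous_on A (\<lambda>t. activity n (u t))"
  using continuous_on_compose2[OF continuous_on_activity[of UNIV] flow_continuous[OF flow]] by auto

lemma activity_integrable: "0 \<le> a \<Longrightarrow> (\<lambda>t. activity n (u t)) integrable_on {a..b}"
  by (intro integrable_continuous_real continuous_on_activity_flow) auto

lemma smooth_time_deriv:
  assumes "t \<in> {0..b}"
  shows "(smooth_time n u has_real_derivative activity n (u t)) (at t within {0..b})"
  unfolding smooth_time_def[abs_def] by (intro integral_has_real_derivative continuous_on_activity_flow assms) auto

lemma smooth_time_deriv_interior:
  assumes "t > 0"
  shows "(smooth_time n u has_real_derivative activity n (u t)) (at t)"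
  using smooth_time_deriv[of t "t + 1" n] assms at_within_interior[of t "{0..t+1}"] by simp

lemma smooth_time_continuous: "continuous_on {0..b} (smooth_time n u)"
  by (auto simp: continuous_on_eq_continuous_within intro!: DERIV_continuous smooth_time_deriv)

lemma smooth_time_increment:
  assumes "0 \<le> a" "a \<le> b"
  shows "0 \<le> smooth_time n u b - smooth_time n u a" and "smooth_time n u b - smooth_time n u a \<le> b - a"
proof -
  have eq: "smooth_time n u b - smooth_time n u a = integral {a..b} (\<lambda>t. activity n (u t))"
    unfolding smooth_time_def
    using Henstock_Kurzweil_Integration.integral_combine[of 0 a b "\<lambda>t. activity n (u t)"] assms
    by (simp add: activity_integrable)
  show "0 \<le> smooth_time n u b - smooth_time n u a" unfolding eq
    by (intro integral_nonneg activity_integrable assms activity_bounds)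
  have "integral {a..b} (\<lambda>t. activity n (u t)) \<le> integral {a..b} (\<lambda>t. 1)"
    by (intro integral_le activity_integrable assms activity_bounds) auto
  then show "smooth_time n u b - smooth_time n u a \<le> b - a" unfolding eq using assms by simp
qed

text \<open>
  Monotone convergence.
\<close>

lemma active_time_limit:
  assumes "0 \<le> t"
  shows "(\<lambda>r. of_bool (g (u r) \<noteq> 0) :: real) integrable_on {0..t}"
    and "(\<lambda>n. smooth_time n u t) \<longlonglongrightarrow> active_time u t"
proof -
  have "bounded (range (\<lambda>n. integral {0..t} (\<lambda>r. activity n (u r))))"
  proof (rule boundedI)
    fix x assume "x \<in> range (\<lambda>n. integral {0..t} (\<lambda>r. activity n (u r)))"
    then obtain n where "x = smooth_time n u t - smooth_time n u 0" by (auto simp: smooth_time_def)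
    then show "norm x \<le> t" using smooth_time_increment[of 0 t n] assms by simp
  qed
  then have "(\<lambda>r. of_bool (g (u r) \<noteq> 0) :: real) integrable_on {0..t} \<and>
      (\<lambda>n. integral {0..t} (\<lambda>r. activity n (u r))) \<longlonglongrightarrow> integral {0..t} (\<lambda>r. of_bool (g (u r) \<noteq> 0))"
    by (intro monotone_convergence_increasing activity_integrable activity_mono activity_tendsto) auto
  then show "(\<lambda>r. of_bool (g (u r) \<noteq> 0) :: real) integrable_on {0..t}"
    and "(\<lambda>n. smooth_time n u t) \<longlonglongrightarrow> active_time u t"
    by (auto simp: smooth_time_def active_time_def)
qed

lemma active_time_0 [simp]: "active_time u 0 = 0"
  by (simp add: active_time_def)

lemma active_time_increment:
  assumes "0 \<le> a" "a \<le> b"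
  shows "0 \<le> active_time u b - active_time u a" and "active_time u b - active_time u a \<le> b - a"
proof -
  have lim: "(\<lambda>k. smooth_time k u b - smooth_time k u a) \<longlonglongrightarrow> active_time u b - active_time u a"
    using assms by (intro tendsto_intros active_time_limit) auto
  show "0 \<le> active_time u b - active_time u a"
    by (rule LIMSEQ_le_const[OF lim]) (use smooth_time_increment[OF assms] in auto)
  show "active_time u b - active_time u a \<le> b - a"
    by (rule LIMSEQ_le_const2[OF lim]) (use smooth_time_increment[OF assms] in auto)
qed

lemma active_time_mono: "0 \<le> a \<Longrightarrow> a \<le> b \<Longrightarrow> active_time u a \<le> active_time u b"
  using active_time_increment[of a b] by simp

lemma active_time_bounds: "0 \<le> t \<Longrightarrow> 0 \<le> active_time u t" "0 \<le> t \<Longrightarrow> active_time u t \<le> t"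
  using active_time_increment[of 0 t] by auto

lemma active_time_continuous: "A \<subseteq> {0..} \<Longrightarrow> continuous_on A (active_time u)"
proof (rule continuous_on_subset)
  have "\<bar>active_time u x - active_time u y\<bar> \<le> \<bar>x - y\<bar>" if "0 \<le> x" "0 \<le> y" for x y
    using active_time_increment[of x y] active_time_increment[of y x] that by linarith
  then show "continuous_on {0..} (active_time u)"
    unfolding continuous_on_iff dist_real_def by (meson atLeast_iff order_le_less_trans)
qed

lemma active_time_no_critical:
  assumes "0 \<le> a" "a \<le> b" and "\<And>t. t \<in> {a..b} \<Longrightarrow> g (u t) \<noteq> 0"
  shows "active_time u b - active_time u a = b - a"
proof -
  have "active_time u b - active_time u a = integral {a..b} (\<lambda>r. of_bool (g (u r) \<noteq> 0))"
    unfolding active_time_def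
    using Henstock_Kurzweil_Integration.integral_combine[of 0 a b "\<lambda>r. of_bool (g (u r) \<noteq> 0) :: real"] assms(1,2)
    by (simp add: active_time_limit)
  also have "\<dots> = integral {a..b} (\<lambda>r. 1)"
    by (rule Henstock_Kurzweil_Integration.integral_cong) (use assms(3) in auto)
  finally show ?thesis using assms by simp
qed

lemma energy_antimono:
  assumes "0 \<le> a" "a \<le> b"
  shows "\<phi> (u b) \<le> \<phi> (u a)"
proof (rule DERIV_nonpos_imp_decreasing_open[OF assms(2)])
  fix t assume "a < t" "t < b"
  then show "\<exists>y. ((\<lambda>t. \<phi> (u t)) has_real_derivative y) (at t) \<and> y \<le> 0"
    using energy_deriv_interior[OF flow, of t] assms by (intro exI[of _ "- (norm (g (u t)))\<^sup>2"]) auto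
qed (use assms in \<open>auto intro!: energy_continuous flow\<close>)

text \<open>
  In terms of active time the velocity is still \<open>- g\<close>, since idle times contribute neither
  displacement nor active time. The proof bounds the velocity of the curve
  \<open>u t + smooth_time n u t *\<^sub>R w\<close> and lets \<open>n\<close> tend to infinity.
\<close>

lemma displacement_estimate:
  assumes ab: "0 \<le> a" "a \<le> b" and w: "\<And>t. t \<in> {a..b} \<Longrightarrow> norm (g (u t) - w) \<le> \<epsilon>"
  shows "norm (u b - u a + (active_time u b - active_time u a) *\<^sub>R w)
    \<le> \<epsilon> * (active_time u b - active_time u a)"
proof (cases "a = b")
  case False
  with ab have "a < b" by simp
  have approx: "norm (u b - u a + (smooth_time n u b - smooth_time n u a) *\<^sub>R w)
      \<le> \<epsilon> * (smooth_time n u b - smooth_time n u a) + (b - a) / sqrt n" if "n > 0" for n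
  proof -
    have "norm ((u b + smooth_time n u b *\<^sub>R w) - (u a + smooth_time n u a *\<^sub>R w))
        \<le> (\<epsilon> * smooth_time n u b + b / sqrt n) - (\<epsilon> * smooth_time n u a + a / sqrt n)"
    proof (rule differentiable_bound_general[OF \<open>a < b\<close>, where
        f = "\<lambda>t. u t + smooth_time n u t *\<^sub>R w" and \<phi> = "\<lambda>t. \<epsilon> * smooth_time n u t + t / sqrt n"
        and f' = "\<lambda>t. - g (u t) + activity n (u t) *\<^sub>R w"
        and \<phi>' = "\<lambda>t. \<epsilon> * activity n (u t) + 1 / sqrt n"])
      have cont_time: "continuous_on {a..b} (smooth_time n u)"
        by (rule continuous_on_subset[OF smooth_time_continuous[of b]]) (use ab in auto)
      then show "continuous_on {a..b} (\<lambda>t. u t + smooth_time n u t *\<^sub>R w)"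
        using ab by (intro continuous_intros flow_continuous flow) auto
      show "continuous_on {a..b} (\<lambda>t. \<epsilon> * smooth_time n u t + t / sqrt n)"
        by (intro continuous_intros cont_time) (use that in auto)
      fix t assume t: "a < t" "t < b"
      then have "t > 0" using ab by simp
      have Sv: "(smooth_time n u has_vector_derivative activity n (u t)) (at t)"
        using smooth_time_deriv_interior[OF \<open>t > 0\<close>] by (simp add: has_real_derivative_iff_has_vector_derivative)
      have "((\<lambda>t. smooth_time n u t *\<^sub>R w) has_vector_derivative activity n (u t) *\<^sub>R w) (at t)"
        using has_vector_derivative_scaleR[OF smooth_time_deriv_interior[OF \<open>t > 0\<close>] has_vector_derivative_const]
        by simp
      then show "((\<lambda>t. u t + smooth_time n u t *\<^sub>R w) has_vector_derivative - g (u t) + activity n (u t) *\<^sub>R w) (at t)"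
        by (intro has_vector_derivative_add flow_deriv_interior flow \<open>t > 0\<close>)
      show "((\<lambda>t. \<epsilon> * smooth_time n u t + t / sqrt n) has_vector_derivative \<epsilon> * activity n (u t) + 1 / sqrt n) (at t)"
        unfolding has_real_derivative_iff_has_vector_derivative[symmetric]
        by (intro DERIV_add DERIV_cmult smooth_time_deriv_interior \<open>t > 0\<close> DERIV_cdivide DERIV_ident)
      let ?\<theta> = "activity n (u t)"
      have "- g (u t) + ?\<theta> *\<^sub>R w = - (?\<theta> *\<^sub>R (g (u t) - w) + (1 - ?\<theta>) *\<^sub>R g (u t))"
        by (simp add: algebra_simps)
      then have "norm (- g (u t) + ?\<theta> *\<^sub>R w) \<le> norm (?\<theta> *\<^sub>R (g (u t) - w)) + norm ((1 - ?\<theta>) *\<^sub>R g (u t))"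
        by (simp only: norm_minus_cancel norm_triangle_ineq)
      also have "\<dots> = ?\<theta> * norm (g (u t) - w) + (1 - ?\<theta>) * norm (g (u t))"
        using activity_bounds[of n "u t"] by simp
      also have "\<dots> \<le> \<epsilon> * ?\<theta> + 1 / sqrt n"
        using w[of t] t activity_bounds(1)[of n "u t"] one_minus_activity_speed[OF that, of "u t"]
          mult_left_mono[of "norm (g (u t) - w)" \<epsilon> ?\<theta>] by (simp add: mult.commute)
      finally show "norm (- g (u t) + ?\<theta> *\<^sub>R w) \<le> \<epsilon> * ?\<theta> + 1 / sqrt n" .
    qed
    then show ?thesis by (simp add: algebra_simps diff_divide_distrib)
  qed
  have l: "(\<lambda>n. smooth_time n u b - smooth_time n u a) \<longlonglongrightarrow> active_time u b - active_time u a"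
    using ab by (intro tendsto_intros active_time_limit) auto
  have "(\<lambda>n. (b - a) / sqrt (real n)) \<longlonglongrightarrow> 0"
    by (intro tendsto_divide_0[OF tendsto_const] filterlim_at_top_imp_at_infinity
        filterlim_compose[OF sqrt_at_top] filterlim_real_sequentially)
  then have "(\<lambda>n. \<epsilon> * (smooth_time n u b - smooth_time n u a) + (b - a) / sqrt n) \<longlonglongrightarrow>
      \<epsilon> * (active_time u b - active_time u a) + 0"
    by (intro tendsto_intros l)
  moreover have "(\<lambda>n. norm (u b - u a + (smooth_time n u b - smooth_time n u a) *\<^sub>R w)) \<longlonglongrightarrow>
      norm (u b - u a + (active_time u b - active_time u a) *\<^sub>R w)"
    by (intro tendsto_intros l)
  ultimately show ?thesis
    using approx LIMSEQ_le by (metis (no_types, lifting) add.right_neutral less_le_trans zero_less_one)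
qed simp

text \<open>
  Young's inequality \<open>q \<le> \<alpha> / 2 * q\<^sup>2 + 1 / (2 * \<alpha>)\<close> for the speed \<open>q\<close> is integrated over
  the active times only, because at the remaining times \<open>q = 0\<close>.
\<close>

lemma displacement_le_energy_and_time:
  assumes ab: "0 \<le> a" "a \<le> b" and \<alpha>: "\<alpha> > 0"
  shows "norm (u b - u a) \<le> \<alpha> / 2 * (\<phi> (u a) - \<phi> (u b)) + (active_time u b - active_time u a) / (2 * \<alpha>)"
proof (cases "a = b")
  case False
  with ab have "a < b" by simp
  have approx: "norm (u b - u a)
      \<le> \<alpha> / 2 * (\<phi> (u a) - \<phi> (u b)) + (smooth_time n u b - smooth_time n u a) / (2 * \<alpha>) + (b - a) / sqrt n" if "n > 0" for n
  proof -
    have "norm (u b - u a)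
        \<le> (- \<alpha> / 2 * \<phi> (u b) + smooth_time n u b / (2 * \<alpha>) + b / sqrt n)
        - (- \<alpha> / 2 * \<phi> (u a) + smooth_time n u a / (2 * \<alpha>) + a / sqrt n)"
    proof (rule differentiable_bound_general[OF \<open>a < b\<close>, where
        f = u and \<phi> = "\<lambda>t. - \<alpha> / 2 * \<phi> (u t) + smooth_time n u t / (2 * \<alpha>) + t / sqrt n"
        and f' = "\<lambda>t. - g (u t)"
        and \<phi>' = "\<lambda>t. - \<alpha> / 2 * (- (norm (g (u t)))\<^sup>2) + activity n (u t) / (2 * \<alpha>) + 1 / sqrt n"])
      have cont_time: "continuous_on {a..b} (smooth_time n u)"
        by (rule continuous_on_subset[OF smooth_time_continuous[of b]]) (use ab in auto)
      show "continuous_on {a..b} u"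
        using ab by (intro flow_continuous flow) auto
      show "continuous_on {a..b} (\<lambda>t. - \<alpha> / 2 * \<phi> (u t) + smooth_time n u t / (2 * \<alpha>) + t / sqrt n)"
        by (intro continuous_intros cont_time energy_continuous flow) (use that \<alpha> ab in auto)
      fix t assume t: "a < t" "t < b"
      then have "t > 0" using ab by simp
      then show "(u has_vector_derivative - g (u t)) (at t)"
        by (intro flow_deriv_interior flow)
      show "((\<lambda>t. - \<alpha> / 2 * \<phi> (u t) + smooth_time n u t / (2 * \<alpha>) + t / sqrt n) has_vector_derivative
          - \<alpha> / 2 * (- (norm (g (u t)))\<^sup>2) + activity n (u t) / (2 * \<alpha>) + 1 / sqrt n) (at t)"
        unfolding has_real_derivative_iff_has_vector_derivative[symmetric]
        by (intro DERIV_add DERIV_cmult smooth_time_deriv_interior energy_deriv_interior flow \<open>t > 0\<close>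
            DERIV_cdivide DERIV_ident)
      let ?\<theta> = "activity n (u t)" and ?q = "norm (g (u t))"
      have young: "?q \<le> \<alpha> / 2 * ?q\<^sup>2 + 1 / (2 * \<alpha>)"
      proof -
        have "0 \<le> (\<alpha> * ?q - 1)\<^sup>2 / (2 * \<alpha>)" using \<alpha> by simp
        also have "\<dots> = \<alpha> / 2 * ?q\<^sup>2 + 1 / (2 * \<alpha>) - ?q"
          using \<alpha> by (simp add: power2_eq_square field_simps)
        finally show ?thesis by simp
      qed
      have "?q = ?\<theta> * ?q + (1 - ?\<theta>) * ?q" by (simp add: algebra_simps)
      also have "\<dots> \<le> ?\<theta> * (\<alpha> / 2 * ?q\<^sup>2 + 1 / (2 * \<alpha>)) + 1 / sqrt n"
        by (intro add_mono mult_left_mono young activity_bounds one_minus_activity_speed that)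
      also have "\<dots> \<le> 1 * (\<alpha> / 2 * ?q\<^sup>2) + ?\<theta> * (1 / (2 * \<alpha>)) + 1 / sqrt n"
        unfolding distrib_left using \<alpha>
        by (intro add_mono mult_right_mono activity_bounds order_refl) auto
      finally show "norm (- g (u t)) \<le> - \<alpha> / 2 * (- ?q\<^sup>2) + ?\<theta> / (2 * \<alpha>) + 1 / sqrt n"
        by simp
    qed
    then show ?thesis by (simp add: algebra_simps diff_divide_distrib)
  qed
  have l: "(\<lambda>n. smooth_time n u b - smooth_time n u a) \<longlonglongrightarrow> active_time u b - active_time u a"
    using ab by (intro tendsto_intros active_time_limit) auto
  have "(\<lambda>n. (b - a) / sqrt (real n)) \<longlonglongrightarrow> 0"
    by (intro tendsto_divide_0[OF tendsto_const] filterlim_at_top_imp_at_infinity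
        filterlim_compose[OF sqrt_at_top] filterlim_real_sequentially)
  then have "(\<lambda>n. \<alpha> / 2 * (\<phi> (u a) - \<phi> (u b)) + (smooth_time n u b - smooth_time n u a) / (2 * \<alpha>) + (b - a) / sqrt n) \<longlonglongrightarrow>
      \<alpha> / 2 * (\<phi> (u a) - \<phi> (u b)) + (active_time u b - active_time u a) / (2 * \<alpha>) + 0"
    using \<alpha> by (intro tendsto_intros l) auto
  then have "norm (u b - u a) \<le>
      \<alpha> / 2 * (\<phi> (u a) - \<phi> (u b)) + (active_time u b - active_time u a) / (2 * \<alpha>) + 0"
    by (rule LIMSEQ_le_const) (use approx in \<open>auto intro!: exI[of _ 1]\<close>)
  then show ?thesis by simp
qed simp

text \<open>
  Optimising the free parameter \<open>\<alpha>\<close> of the preceding estimate gives what Cauchy--Schwarz would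
  give for the integral of the speed over the active times. The bound carries the whole theory:
  no loss of energy, or no active time, means no motion.
\<close>

lemma displacement_sq_le:
  assumes ab: "0 \<le> a" "a \<le> b"
  shows "(norm (u b - u a))\<^sup>2 \<le> (active_time u b - active_time u a) * (\<phi> (u a) - \<phi> (u b))"
proof -
  let ?x = "norm (u b - u a)" and ?D = "\<phi> (u a) - \<phi> (u b)"
    and ?s = "active_time u b - active_time u a"
  have D: "0 \<le> ?D" and s: "0 \<le> ?s"
    using energy_antimono[OF ab] active_time_increment[OF ab] by auto
  have est: "\<alpha> * ?x \<le> \<alpha>\<^sup>2 / 2 * ?D + ?s / 2" if "\<alpha> > 0" for \<alpha>
    using mult_left_mono[OF displacement_le_energy_and_time[OF ab that], of \<alpha>] that
    by (simp add: distrib_left power2_eq_square)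
  show ?thesis
  proof (cases "?x = 0")
    case True then show ?thesis using D s by simp
  next
    case False
    then have x: "?x > 0" by simp
    have "?D \<noteq> 0"
    proof
      assume "?D = 0"
      then have "\<alpha> * ?x \<le> ?s / 2" if "\<alpha> > 0" for \<alpha> using est[OF that] by simp
      \<comment> \<open>without loss of energy only the left-hand side grows with \<open>\<alpha>\<close>, so a large \<open>\<alpha>\<close> refutes the estimate\<close>
      from this[of "(?s + 1) / ?x"] show False using x s by (simp add: divide_pos_pos)
    qed
    then have D: "?D > 0" using D by simp
    define q where "q = ?x\<^sup>2 / ?D"
    have eqs: "?x / ?D * ?x = q" "(?x / ?D)\<^sup>2 / 2 * ?D = q / 2"
      using D by (simp_all add: q_def power2_eq_square)
    \<comment> \<open>for \<open>\<alpha> = ?x / ?D\<close> half of the left-hand side absorbs the first term on the right\<close>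
    have "?x / ?D * ?x \<le> (?x / ?D)\<^sup>2 / 2 * ?D + ?s / 2" by (rule est) (use x D in simp)
    then have "q \<le> q / 2 + ?s / 2" by (simp only: eqs)
    then have "q \<le> ?s" by argo
    then have "?x\<^sup>2 / ?D \<le> ?s" by (simp only: q_def)
    then show ?thesis using D by (simp add: divide_le_eq)
  qed
qed

lemma eq_if_energy_ge:
  assumes "0 \<le> a" "a \<le> b" "\<phi> (u a) \<le> \<phi> (u b)"
  shows "u b = u a"
proof -
  have "(active_time u b - active_time u a) * (\<phi> (u a) - \<phi> (u b)) \<le> 0"
    using assms active_time_increment[of a b] by (intro mult_nonneg_nonpos) auto
  then show ?thesis using displacement_sq_le[OF assms(1,2)]
    by (metis eq_iff_diff_eq_0 norm_eq_zero order_antisym_conv order_trans zero_eq_power2 zero_le_power2)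
qed

lemma eq_if_active_time_eq:
  assumes "0 \<le> a" "a \<le> b" "active_time u a = active_time u b"
  shows "u b = u a"
  using displacement_sq_le[OF assms(1,2)] assms(3) by simp

lemma eq_iff_energy_eq:
  assumes "0 \<le> a" "0 \<le> b"
  shows "u a = u b \<longleftrightarrow> \<phi> (u a) = \<phi> (u b)"
  using eq_if_energy_ge[of a b] eq_if_energy_ge[of b a] assms by (metis nle_le)

text \<open>
  For fixed \<open>n\<close>, approximate active time is a Lipschitz function of the energy, because
  \<open>level_weight n\<close> is at most \<open>n\<close>.
\<close>

lemma smooth_time_increment_le_energy:
  assumes "0 \<le> a" "a \<le> b"
  shows "smooth_time n u b - smooth_time n u a \<le> n * (\<phi> (u a) - \<phi> (u b))"
proof -
  have "n * \<phi> (u b) + smooth_time n u b \<le> n * \<phi> (u a) + smooth_time n u a"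
  proof (rule DERIV_nonpos_imp_decreasing_open[OF assms(2)])
    fix t assume t: "a < t" "t < b"
    have "((\<lambda>t. n * \<phi> (u t) + smooth_time n u t) has_real_derivative
        n * - (norm (g (u t)))\<^sup>2 + activity n (u t)) (at t)"
      using t assms by (intro DERIV_add DERIV_cmult energy_deriv_interior flow smooth_time_deriv_interior) auto
    moreover have "n * - (norm (g (u t)))\<^sup>2 + activity n (u t) \<le> 0"
      unfolding activity_def using level_weight_bounds(2)[of n "u t"] by (simp add: mult_right_mono)
    ultimately show "\<exists>y. ((\<lambda>t. n * \<phi> (u t) + smooth_time n u t) has_real_derivative y) (at t) \<and> y \<le> 0"
      by blast
  next
    have "continuous_on {a..b} (smooth_time n u)"
      by (rule continuous_on_subset[OF smooth_time_continuous[of b]]) (use assms in auto)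
    then show "continuous_on {a..b} (\<lambda>t. n * \<phi> (u t) + smooth_time n u t)"
      using assms by (intro continuous_intros energy_continuous flow) auto
  qed
  then show ?thesis by (simp add: algebra_simps)
qed

end

section \<open>Active time depends only on the trace\<close>

lemma energy_image:
  assumes "flow u" "0 \<le> a"
  shows "\<phi> ` u ` {0..a} = {\<phi> (u a)..\<phi> (u 0)}"
proof
  show "\<phi> ` u ` {0..a} \<subseteq> {\<phi> (u a)..\<phi> (u 0)}"
    using energy_antimono[OF assms(1)] by auto
  show "{\<phi> (u a)..\<phi> (u 0)} \<subseteq> \<phi> ` u ` {0..a}"
  proof
    fix y assume "y \<in> {\<phi> (u a)..\<phi> (u 0)}"
    then obtain x where "0 \<le> x" "x \<le> a" "\<phi> (u x) = y"
      using IVT2'[of "\<lambda>t. \<phi> (u t)" a y 0] energy_continuous[OF assms(1), of "{0..a}"] assms(2) by auto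
    then show "y \<in> \<phi> ` u ` {0..a}" by auto
  qed
qed

text \<open>
  The energy is injective on the compact set \<open>u ` {0..a}\<close>, so this set has a continuous
  parametrisation \<open>p\<close> by the energy level. For every solution \<open>w\<close> inside the set, the derivative
  of \<open>smooth_time n w\<close> is \<open>level_weight n (p (\<phi> (w t)))\<close> times the rate of decrease of
  \<open>\<phi> (w t)\<close>, so \<open>smooth_time n w\<close> depends only on the energies at the two ends.
\<close>

lemma active_time_intrinsic:
  assumes u: "flow u" and v: "flow v" and ab: "0 \<le> a" "0 \<le> b"
    and ends: "u 0 = v 0" "u a = v b" and sub: "v ` {0..b} \<subseteq> u ` {0..a}"
  shows "active_time u a = active_time v b"
proof -
  let ?K = "u ` {0..a}" and ?I = "{\<phi> (u a)..\<phi> (u 0)}"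
  define p where "p = inv_into ?K \<phi>"
  have p: "p (\<phi> x) = x" if "x \<in> ?K" for x
    unfolding p_def
    by (rule inv_into_f_f) (use that eq_iff_energy_eq[OF u] in \<open>auto intro!: inj_onI\<close>)
  have I: "\<phi> ` ?K = ?I" by (rule energy_image[OF u ab(1)])
  have cont_p: "continuous_on ?I p"
    unfolding I[symmetric] using p
    by (intro continuous_on_inv continuous_on_\<phi> compact_continuous_image flow_continuous u) auto
  have S_eq: "smooth_time n u a = smooth_time n v b" for n
  proof -
    \<comment> \<open>the common primitive of the level density; it makes \<open>G (\<phi> (w t)) + smooth_time n w t\<close> constant\<close>
    define G where "G l = integral {\<phi> (u a)..l} (\<lambda>m. level_weight n (p m))" for l
    have G: "(G has_real_derivative level_weight n (p l)) (at l within ?I)" if "l \<in> ?I" for l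
      unfolding G_def[abs_def]
      by (intro integral_has_real_derivative that
          continuous_on_compose2[OF continuous_on_level_weight[of UNIV] cont_p]) auto
    have S_level: "smooth_time n w T = G (\<phi> (w 0)) - G (\<phi> (w T))"
      if w: "flow w" and T: "0 \<le> T" and sub: "w ` {0..T} \<subseteq> ?K" for w T
    proof -
      have "((\<lambda>t. G (\<phi> (w t)) + smooth_time n w t) has_real_derivative 0) (at t within {0..T})"
        if t: "t \<in> {0..T}" for t
      proof -
        have wt: "w t \<in> ?K" using sub t by auto
        have im: "(\<lambda>t. \<phi> (w t)) ` {0..T} \<subseteq> ?I" using sub I by blast
        have E: "((\<lambda>t. \<phi> (w t)) has_real_derivative - (norm (g (w t)))\<^sup>2) (at t within {0..T})"
          using energy_deriv[OF w, of t] t by (auto intro: has_field_derivative_subset)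
        have "(G has_real_derivative level_weight n (p (\<phi> (w t)))) (at (\<phi> (w t)) within (\<lambda>t. \<phi> (w t)) ` {0..T})"
          using im t by (intro has_field_derivative_subset[OF G im]) blast
        from DERIV_image_chain[OF this E]
        have "((\<lambda>t. G (\<phi> (w t))) has_real_derivative level_weight n (w t) * - (norm (g (w t)))\<^sup>2) (at t within {0..T})"
          by (simp add: o_def p[OF wt])
        from DERIV_add[OF this smooth_time_deriv[OF w t, of n]]
        show ?thesis by (simp add: activity_def)
      qed
      then obtain c where "\<And>t. t \<in> {0..T} \<Longrightarrow> G (\<phi> (w t)) + smooth_time n w t = c"
        using has_field_derivative_zero_constant[of "{0..T}" "\<lambda>t. G (\<phi> (w t)) + smooth_time n w t"] by auto
      from this[of 0] this[of T] show ?thesis using T by (simp add: smooth_time_def)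
    qed
    show ?thesis using S_level[OF u ab(1)] S_level[OF v ab(2) sub] ends by simp
  qed
  have "(\<lambda>n. smooth_time n u a) \<longlonglongrightarrow> active_time v b"
    unfolding S_eq by (rule active_time_limit[OF v ab(2)])
  with active_time_limit(2)[OF u ab(1)] show ?thesis by (rule LIMSEQ_unique)
qed

text \<open>
  A solution that takes the same value at two times is constant in between.
\<close>

lemma active_time_eq_if_eq:
  assumes u: "flow u" and ab: "0 \<le> a" "a \<le> b" and eq: "u a = u b"
  shows "active_time u a = active_time u b"
proof (rule active_time_intrinsic[OF u u])
  show "u ` {0..b} \<subseteq> u ` {0..a}"
  proof
    fix z assume "z \<in> u ` {0..b}"
    then obtain y where y: "0 \<le> y" "y \<le> b" "z = u y" by auto
    show "z \<in> u ` {0..a}"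
    proof (cases "y \<le> a")
      case False
      then have "\<phi> (u y) = \<phi> (u a)"
        using energy_antimono[OF u, of y b] energy_antimono[OF u, of a y] eq ab y by simp
      then have "u y = u a" using eq_iff_energy_eq[OF u, of y a] y ab by simp
      then show ?thesis using y ab by auto
    qed (use y in auto)
  qed
qed (use assms in auto)

section \<open>The closure of the range of a solution\<close>

lemma closure_range_energy_ge:
  assumes "x \<in> closure (Rg u)" "\<And>t. 0 \<le> t \<Longrightarrow> l \<le> \<phi> (u t)"
  shows "l \<le> \<phi> x"
proof -
  have "closed {x. l \<le> \<phi> x}" by (intro closed_Collect_le continuous_on_\<phi> continuous_on_const)
  then have "closure (Rg u) \<subseteq> {x. l \<le> \<phi> x}"
    by (rule closure_minimal[rotated]) (use assms(2) in \<open>auto simp: Rg_def\<close>)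
  then show ?thesis using assms(1) by auto
qed

lemma closure_range_energy_le:
  assumes "flow u" "x \<in> closure (Rg u)"
  shows "\<phi> x \<le> \<phi> (u 0)"
proof -
  have "closed {x. \<phi> x \<le> \<phi> (u 0)}" by (intro closed_Collect_le continuous_on_\<phi> continuous_on_const)
  then have "closure (Rg u) \<subseteq> {x. \<phi> x \<le> \<phi> (u 0)}"
    by (rule closure_minimal[rotated]) (use energy_antimono[OF assms(1)] in \<open>auto simp: Rg_def\<close>)
  then show ?thesis using assms(2) by auto
qed

text \<open>
  Points of the range whose energy exceeds \<open>\<phi> (u r)\<close> have been visited before \<open>r\<close>, and the part
  of the range up to \<open>r\<close> is compact.
\<close>

lemma closure_range_above_level:
  assumes u: "flow u" and x: "x \<in> closure (Rg u)" and r: "0 \<le> r" "\<phi> (u r) < \<phi> x"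
  shows "x \<in> u ` {0..r}"
proof -
  let ?U = "{x. \<phi> (u r) < \<phi> x}"
  have "open ?U" by (intro open_Collect_less continuous_on_\<phi> continuous_on_const)
  then have "x \<in> closure (?U \<inter> Rg u)"
    using open_Int_closure_subset[of ?U "Rg u"] x r(2) by auto
  moreover have "?U \<inter> Rg u \<subseteq> u ` {0..r}"
  proof
    fix y assume y: "y \<in> ?U \<inter> Rg u"
    then obtain t where t: "0 \<le> t" "y = u t" by (auto simp: Rg_def)
    then have "t \<le> r" using energy_antimono[OF u r(1), of t] y by (cases "t \<le> r") auto
    then show "y \<in> u ` {0..r}" using t by auto
  qed
  moreover have "closed (u ` {0..r})"
    by (intro compact_imp_closed compact_continuous_image flow_continuous u) auto
  ultimately show ?thesis using closure_minimal by blast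
qed

lemma constant_if_energy_ge:
  assumes "flow u" "0 \<le> r" "\<And>t. r \<le> t \<Longrightarrow> \<phi> (u r) \<le> \<phi> (u t)" "r \<le> t"
  shows "u t = u r"
  using eq_if_energy_ge[OF assms(1,2,4)] assms(3,4) by auto

text \<open>
  Limit points at infinity all have the infimum of the energy along \<open>u\<close>. If \<open>u\<close> attains this
  infimum it stays there and its range is closed, so an energy that \<open>u\<close> attains determines the
  point, even among the points of the closure.
\<close>

lemma closure_range_eq:
  assumes u: "flow u" and x: "x \<in> closure (Rg u)" and r: "0 \<le> r" "\<phi> x = \<phi> (u r)"
  shows "x = u r"
proof (cases "\<exists>t\<ge>r. \<phi> (u t) < \<phi> (u r)")
  case True
  then obtain t where "t \<ge> r" "\<phi> (u t) < \<phi> x" using r by auto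
  then obtain y where "y \<ge> 0" "x = u y" using closure_range_above_level[OF u x, of t] r by auto
  then show ?thesis using eq_iff_energy_eq[OF u, of y r] r by simp
next
  case False
  then have const: "u t = u r" if "r \<le> t" for t
    by (intro constant_if_energy_ge u r that) (use not_le_imp_less in blast)
  have "Rg u \<subseteq> u ` {0..r}"
  proof
    fix z assume "z \<in> Rg u"
    then obtain t where t: "t \<ge> 0" "z = u t" by (auto simp: Rg_def)
    then show "z \<in> u ` {0..r}" using const[of t] r(1) by (cases "t \<le> r") auto
  qed
  moreover have "closed (u ` {0..r})"
    by (intro compact_imp_closed compact_continuous_image flow_continuous u) auto
  ultimately have "x \<in> u ` {0..r}" using x closure_minimal by blast
  then show ?thesis using eq_iff_energy_eq[OF u, of _ r] r by auto
qed

lemma constant_at_minimum_of_range: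
  assumes u: "flow u" and v: "flow v" and sub: "Rg v \<subseteq> closure (Rg u)"
    and T: "0 \<le> T" "v T = u T" "\<And>t. T \<le> t \<Longrightarrow> u t = u T" and t: "T \<le> t"
  shows "v t = u T"
proof -
  have "v t \<in> closure (Rg u)" using sub T(1) t by (auto simp: Rg_def)
  moreover have "\<phi> (u T) \<le> \<phi> (u r)" if "0 \<le> r" for r
    using energy_antimono[OF u that, of T] T(3)[of r] by (cases "r \<le> T") auto
  ultimately have "\<phi> (v T) \<le> \<phi> (v t)" using closure_range_energy_ge T(2) by simp
  then show ?thesis using eq_if_energy_ge[OF v T(1) t] T(2) by simp
qed

text \<open>
  Both starting points have the largest energy on \<open>closure (Rg y)\<close>.
\<close>

lemma initial_value_of_enlarged_range:
  assumes y: "flow y" and u: "flow u" and sub: "Rg y \<subseteq> Rg u" "Rg u \<subseteq> closure (Rg y)"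
  shows "u 0 = y 0"
proof -
  obtain r where r: "0 \<le> r" "y 0 = u r" using sub(1) by (auto simp: Rg_def)
  have "u 0 \<in> closure (Rg y)" using sub(2) by (auto simp: Rg_def)
  then have "\<phi> (u 0) \<le> \<phi> (u r)" using closure_range_energy_le[OF y] r by simp
  then have "\<phi> (u 0) = \<phi> (u r)" using energy_antimono[OF u _ r(1)] by simp
  then show ?thesis using eq_iff_energy_eq[OF u, of 0 r] r by simp
qed

section \<open>Tight solutions\<close>

text \<open>
  Until it stops, a tight solution never idles for a set of times of positive measure.
\<close>

definition tight :: "(real \<Rightarrow> 'a) \<Rightarrow> bool" where
  "tight u \<longleftrightarrow> (\<forall>t\<ge>0. ereal t < T_star u \<longrightarrow> active_time u t = t)"

lemma T_star_le_iff_flow: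
  assumes "flow u" "0 \<le> t"
  shows "T_star u \<le> ereal t \<longleftrightarrow> (\<forall>s\<ge>t. u s = u t)"
  by (rule T_star_le_iff) (auto intro: flow_continuous assms)

text \<open>
  The hypothesis makes active time idempotent. If it fell behind the clock at some \<open>t\<close>, then by
  continuity any further growth after \<open>t\<close> would first pass through values below \<open>t\<close>, and
  idempotence forbids this. So it would be stationary from \<open>t\<close> on, and \<open>u\<close> with it.
\<close>

lemma tightI:
  assumes u: "flow u" and inv: "\<And>t. 0 \<le> t \<Longrightarrow> u (active_time u t) = u t"
  shows "tight u"
  unfolding tight_def
proof (intro allI impI, rule ccontr)
  fix t :: real
  assume t: "0 \<le> t" "ereal t < T_star u" and "active_time u t \<noteq> t"
  let ?s = "active_time u"
  have idem: "?s (?s x) = ?s x" if x: "0 \<le> x" for x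
    using active_time_eq_if_eq[OF u active_time_bounds[OF u x] inv[OF x]] .
  define \<sigma> where "\<sigma> = ?s t"
  have \<sigma>: "\<sigma> < t" using \<open>?s t \<noteq> t\<close> active_time_bounds[OF u t(1)] by (simp add: \<sigma>_def)
  have stop: "?s x = \<sigma>" if x: "t \<le> x" for x
  proof (rule ccontr)
    assume "?s x \<noteq> \<sigma>"
    then have gt: "\<sigma> < ?s x" using active_time_mono[OF u t(1) x] by (simp add: \<sigma>_def)
    \<comment> \<open>a value strictly between \<open>\<sigma>\<close> and both \<open>t\<close> and \<open>?s x\<close>\<close>
    define \<sigma>' where "\<sigma>' = (\<sigma> + min t (?s x)) / 2"
    have \<sigma>': "\<sigma> < \<sigma>'" "\<sigma>' < t" "\<sigma>' < ?s x" using gt \<sigma> by (auto simp: \<sigma>'_def min_def)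
    obtain y where y: "t \<le> y" "y \<le> x" "?s y = \<sigma>'"
      using IVT'[of ?s t \<sigma>' x] \<sigma>' x t active_time_continuous[OF u, of "{t..x}"] by (auto simp: \<sigma>_def)
    then have "?s \<sigma>' = \<sigma>'" using idem[of y] t by simp
    moreover have "?s \<sigma>' \<le> \<sigma>" unfolding \<sigma>_def
      using active_time_bounds[OF u, of y] y t \<sigma>' by (intro active_time_mono u) auto
    ultimately show False using \<sigma>' by simp
  qed
  have "u x = u t" if "t \<le> x" for x
    using inv[of x] inv[of t] stop[OF that] stop[of t] t that by simp
  then have "T_star u \<le> ereal t" using T_star_le_iff_flow[OF u t(1)] by blast
  with t show False by simp
qed

lemma tight_min_le:
  assumes u: "flow u" and "tight u" and t: "0 \<le> t"
  shows "min (ereal t) (T_star u) \<le> ereal (active_time u t)"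
proof (cases "ereal t < T_star u")
  case True
  then show ?thesis using assms by (simp add: tight_def)
next
  case False
  then obtain T where T: "T_star u = ereal T" "0 \<le> T" "T \<le> t"
    using T_star_nonneg[of u] by (cases "T_star u") auto
  have "T \<le> active_time u t"
  proof (cases "T = 0")
    case True then show ?thesis using active_time_bounds[OF u t] by simp
  next
    case False
    show ?thesis
    \<comment> \<open>tightness says nothing at \<open>T_star u\<close> itself, so approach it from below\<close>
    proof (rule dense_le_bounded[of 0])
      show "0 < T" using False T by simp
      fix x assume x: "0 < x" "x < T"
      then have "active_time u x = x" using assms(2) T by (simp add: tight_def)
      then show "x \<le> active_time u t" using active_time_mono[OF u, of x t] x T by simp
    qed
  qed
  then show ?thesis by (simp add: T min.coboundedI2)
qed

text \<open>
  If \<open>u t = v (z t)\<close>, then \<open>active_time u t = active_time v (z t) \<le> z t \<le> t\<close>, and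
  tightness turns these into equalities up to \<open>T_star u\<close>. From then on \<open>u\<close> rests at the
  minimum of \<open>\<phi>\<close> on \<open>closure (Rg u)\<close>, which \<open>v\<close> cannot leave.
\<close>

lemma tight_minimal:
  assumes u: "flow u" and tight: "tight u" and v: "flow v" and "u \<succ> v" and t: "0 \<le> t"
  shows "u t = v t"
proof -
  obtain z where sub: "Rg v \<subseteq> closure (Rg u)" and z: "z \<in> {0..} \<rightarrow> {0..}" "z 0 = 0"
    and lip: "\<And>s t. 0 \<le> s \<Longrightarrow> s \<le> t \<Longrightarrow> 0 \<le> z t - z s \<and> z t - z s \<le> t - s"
    and uz: "\<And>t. t \<ge> 0 \<Longrightarrow> u t = v (z t)"
    using assms(4) unfolding succeeds_def by blast
  have "\<bar>z x - z y\<bar> \<le> \<bar>x - y\<bar>" if "0 \<le> x" "0 \<le> y" for x y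
    using lip[of x y] lip[of y x] that by linarith
  then have cont: "continuous_on {0..} z"
    unfolding continuous_on_iff dist_real_def by (meson atLeast_iff order_le_less_trans)
  have le: "active_time u t \<le> z t" if t: "0 \<le> t" for t
  proof -
    have zt: "0 \<le> z t" using z t by auto
    have "active_time u t = active_time v (z t)"
    proof (rule active_time_intrinsic[OF u v t zt])
      show "v ` {0..z t} \<subseteq> u ` {0..t}"
      proof
        fix y assume "y \<in> v ` {0..z t}"
        then obtain r where r: "0 \<le> r" "r \<le> z t" "y = v r" by auto
        obtain x where "0 \<le> x" "x \<le> t" "z x = r"
          using IVT'[of z 0 r t] r z t continuous_on_subset[OF cont, of "{0..t}"] by auto
        then show "y \<in> u ` {0..t}" using r uz by auto
      qed
    qed (use uz[of 0] uz[OF t] z in auto)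
    also have "\<dots> \<le> z t" by (rule active_time_bounds[OF v zt])
    finally show ?thesis .
  qed
  have z_id: "z t = t" if "0 \<le> t" "ereal t \<le> T_star u" for t
    using tight_min_le[OF u tight that(1)] le[OF that(1)] lip[of 0 t] z that by (simp add: min_def split: if_splits)
  show ?thesis
  proof (cases "ereal t \<le> T_star u")
    case True then show ?thesis using uz[OF t] z_id[OF t] by simp
  next
    case False
    then obtain T where T: "T_star u = ereal T" "0 \<le> T" "T \<le> t"
      using T_star_nonneg[of u] by (cases "T_star u") auto
    then have const: "u x = u T" if "T \<le> x" for x
      using T_star_le_iff_flow[OF u T(2)] T(1) that by (metis order_refl)
    have "v T = u T" using uz[OF T(2)] z_id[OF T(2)] T by simp
    from constant_at_minimum_of_range[OF u v sub T(2) this const T(3)] const[OF T(3)]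
    show ?thesis by simp
  qed
qed

text \<open>
  Before it reaches \<open>u t\<close>, the competitor \<open>w\<close> can only visit points of the closure whose energy
  is attained by \<open>u\<close> up to \<open>t\<close>, so its trace is contained in that of \<open>u\<close>.
\<close>

lemma tight_arrival_time:
  assumes u: "flow u" "tight u" and w: "flow w" "w 0 = u 0" and b: "0 \<le> b"
    and sub: "w ` {0..b} \<subseteq> closure (Rg u)" and t: "0 \<le> t" and meet: "u t = w b"
  shows "min (ereal t) (T_star u) \<le> ereal b"
proof -
  have "active_time u t = active_time w b"
  proof (rule active_time_intrinsic[OF u(1) w(1) t b])
    show "w ` {0..b} \<subseteq> u ` {0..t}"
    proof
      fix z assume "z \<in> w ` {0..b}"
      then obtain x where x: "0 \<le> x" "x \<le> b" "z = w x" by auto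
      have "\<phi> z \<in> {\<phi> (u t)..\<phi> (u 0)}"
        using energy_antimono[OF w(1), of 0 x] energy_antimono[OF w(1), of x b] x meet w by simp
      then have "\<phi> z \<in> \<phi> ` u ` {0..t}" using energy_image[OF u(1) t] by simp
      then obtain r where r: "0 \<le> r" "r \<le> t" "\<phi> z = \<phi> (u r)" by auto
      have "z \<in> closure (Rg u)" using sub x by auto
      then have "z = u r" using closure_range_eq[OF u(1)] r by simp
      then show "z \<in> u ` {0..t}" using r by auto
    qed
  qed (use w meet in auto)
  then have "active_time u t \<le> b" using active_time_bounds[OF w(1) b] by simp
  then show ?thesis using tight_min_le[OF u t] by (meson ereal_less_eq(3) order_trans)
qed

text \<open>
  If \<open>w\<close> were below \<open>u\<close> at time \<open>b\<close>, it would have reached the point \<open>u b\<close> strictly before \<open>b\<close>.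
  Earliest arrival allows this only if \<open>u\<close> has stopped by then, at the lowest energy on
  \<open>closure (Rg u)\<close>.
\<close>

lemma tight_energy_least:
  assumes u: "flow u" "tight u" and w: "flow w" "w 0 = u 0" and b: "0 \<le> b"
    and sub: "w ` {0..b} \<subseteq> closure (Rg u)"
  shows "\<phi> (u b) \<le> \<phi> (w b)"
proof (rule ccontr)
  assume "\<not> \<phi> (u b) \<le> \<phi> (w b)"
  then have lt: "\<phi> (w b) < \<phi> (u b)" by simp
  have "\<phi> (u b) \<in> {\<phi> (w b)..\<phi> (w 0)}" using lt w energy_antimono[OF u(1), of 0 b] b by simp
  then obtain x where x: "0 \<le> x" "x \<le> b" "\<phi> (w x) = \<phi> (u b)"
    unfolding energy_image[OF w(1) b, symmetric] by auto
  have "x < b" using x lt by (cases "x = b") auto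
  have "w x \<in> closure (Rg u)" using sub x by auto
  then have "w x = u b" using closure_range_eq[OF u(1) _ b x(3)] by simp
  moreover have "w ` {0..x} \<subseteq> closure (Rg u)" using sub x by auto
  ultimately have "min (ereal b) (T_star u) \<le> ereal x"
    using tight_arrival_time[OF u w x(1) _ b] by simp
  then have "T_star u \<le> ereal x" using \<open>x < b\<close> by (auto simp: min_le_iff_disj)
  then have const: "u s = u x" if "x \<le> s" for s
    using T_star_le_iff_flow[OF u(1) x(1)] that by blast
  have "\<phi> (u b) \<le> \<phi> (u s)" if "0 \<le> s" for s
    using energy_antimono[OF u(1) that, of b] const[of s] const[of b] \<open>x < b\<close> by (cases "s \<le> b") auto
  then have "\<phi> (u b) \<le> \<phi> (w b)"
    by (rule closure_range_energy_ge[rotated]) (use sub b in auto)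
  with lt show False by simp
qed

lemma tight_same_trace_unique:
  assumes u: "flow u" "tight u" and v: "flow v" "tight v" and "u 0 = v 0"
    and "Rg u \<subseteq> closure (Rg v)" "Rg v \<subseteq> closure (Rg u)" and t: "0 \<le> t"
  shows "u t = v t"
proof -
  have "\<phi> (u t) \<le> \<phi> (v t)"
    by (rule tight_energy_least[OF u v(1) _ t]) (use assms in \<open>auto simp: Rg_def\<close>)
  moreover have "\<phi> (v t) \<le> \<phi> (u t)"
    by (rule tight_energy_least[OF v u(1) _ t]) (use assms in \<open>auto simp: Rg_def\<close>)
  ultimately have "\<phi> (v t) = \<phi> (u t)" by simp
  moreover have "v t \<in> closure (Rg u)" using assms by (auto simp: Rg_def)
  ultimately show ?thesis using closure_range_eq[OF u(1) _ t, of "v t"] by simp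
qed

text \<open>
  Equal energies mean equal points and therefore equal active times.
\<close>

lemma tight_injective:
  assumes u: "flow u" "tight u" and t: "0 \<le> a" "ereal a < T_star u" "0 \<le> b" "ereal b < T_star u"
    and eq: "\<phi> (u a) = \<phi> (u b)"
  shows "a = b"
proof -
  have "u a = u b" using eq_iff_energy_eq[OF u(1) t(1,3)] eq by blast
  then have "active_time u a = active_time u b"
    using active_time_eq_if_eq[OF u(1), of a b] active_time_eq_if_eq[OF u(1), of b a] t(1,3)
    by (metis linear)
  moreover have "active_time u a = a" "active_time u b = b" using u(2) t unfolding tight_def by blast+
  ultimately show ?thesis by simp
qed

lemma tight_energy_strict:
  assumes u: "flow u" "tight u" and t: "0 \<le> a" "a < b" "ereal b < T_star u"
  shows "\<phi> (u b) < \<phi> (u a)"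
proof -
  have "ereal a < T_star u" using t by (auto intro: less_trans[of _ "ereal b"])
  then have "\<phi> (u b) \<noteq> \<phi> (u a)" using tight_injective[OF u, of b a] t by auto
  then show ?thesis using energy_antimono[OF u(1), of a b] t by simp
qed

section \<open>Tightness and the set of critical times\<close>

text \<open>
  Measurability is needed because \<open>emeasure\<close> assigns \<open>0\<close> to non-measurable sets.
\<close>

lemma critical_set_measurable:
  assumes "flow u"
  shows "{t. 0 \<le> t \<and> ereal t < T_star u \<and> g (u t) = 0} \<in> sets lebesgue"
proof -
  have "closed ({0..} \<inter> (\<lambda>t. g (u t)) -` {0})"
    by (rule continuous_closed_preimage)
      (auto intro: continuous_on_compose2[OF cont_g flow_continuous[OF assms]])
  then have "{0..} \<inter> (\<lambda>t. g (u t)) -` {0} \<in> sets lebesgue"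
    by (intro sets_completionI_sets) (simp only: sets_lborel borel_closed)
  moreover have "open {t. ereal t < T_star u}"
    by (intro open_Collect_less continuous_on_const continuous_on_ereal continuous_on_id)
  then have "{t. ereal t < T_star u} \<in> sets lebesgue"
    by (intro sets_completionI_sets) (simp only: sets_lborel borel_open)
  ultimately have "({0..} \<inter> (\<lambda>t. g (u t)) -` {0}) \<inter> {t. ereal t < T_star u} \<in> sets lebesgue"
    by (rule sets.Int)
  also have "({0..} \<inter> (\<lambda>t. g (u t)) -` {0}) \<inter> {t. ereal t < T_star u} =
      {t. 0 \<le> t \<and> ereal t < T_star u \<and> g (u t) = 0}" by auto
  finally show ?thesis .
qed

text \<open>
  The critical times in \<open>{0..t}\<close> have measure \<open>t - active_time u t\<close>. For the
  converse, countably many of these sets, one for each rational time before \<open>T_star u\<close>, cover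
  the critical times.
\<close>

lemma tight_iff_critical_set_null:
  assumes u: "flow u"
  shows "tight u \<longleftrightarrow> emeasure lebesgue {t. 0 \<le> t \<and> ereal t < T_star u \<and> g (u t) = 0} = 0"
    (is "_ \<longleftrightarrow> emeasure lebesgue ?N = 0")
proof -
  have "emeasure lebesgue ?N = 0 \<longleftrightarrow> negligible ?N"
    using critical_set_measurable[OF u] by (auto simp: negligible_iff_emeasure0)
  also have "\<dots> \<longleftrightarrow> tight u"
  proof
    assume N: "negligible ?N"
    show "tight u" unfolding tight_def
    proof (intro allI impI)
      fix t assume t: "0 \<le> t" "ereal t < T_star u"
      have "active_time u t = integral {0..t} (\<lambda>r. 1)"
        unfolding active_time_def
      proof (rule integral_spike[OF N])
        fix x assume "x \<in> {0..t} - ?N"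
        moreover from this have "ereal x < T_star u"
          using t(2) by (auto intro: le_less_trans[of _ "ereal t"])
        ultimately show "1 = (of_bool (g (u x) \<noteq> 0) :: real)" by auto
      qed
      then show "active_time u t = t" using t by simp
    qed
  next
    assume tight: "tight u"
    let ?C = "\<lambda>t. {r \<in> {0..t}. g (u r) = 0}"
    have neg: "negligible (?C t)" if t: "0 \<le> t" "ereal t < T_star u" for t
    proof -
      have "((\<lambda>r. 1 - of_bool (g (u r) \<noteq> 0)) has_integral (t - active_time u t)) {0..t}"
        using has_integral_diff[OF has_integral_const_real[of "1::real" 0 t]
            integrable_integral[OF active_time_limit(1)[OF u t(1)]]] t(1)
        by (simp add: active_time_def)
      moreover have "active_time u t = t" using tight t by (simp add: tight_def)
      moreover have "(\<lambda>r. 1 - of_bool (g (u r) \<noteq> 0)) = (\<lambda>r. if r \<in> {r. g (u r) = 0} then 1 else 0 :: real)"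
        by auto
      ultimately have "((\<lambda>r. if r \<in> {r. g (u r) = 0} then 1 else 0 :: real) has_integral 0) {0..t}"
        by simp
      then have "((\<lambda>r. 1 :: real) has_integral 0) ({r. g (u r) = 0} \<inter> {0..t})"
        by (simp only: has_integral_restrict_Int)
      then show ?thesis
        by (simp add: negligible_iff_measure lmeasurable_iff_integrable_on lmeasure_integral
            has_integral_iff Int_def conj_commute)
    qed
    have "negligible (\<Union>t\<in>{t \<in> \<rat>. 0 \<le> t \<and> ereal t < T_star u}. ?C t)"
      using neg by (intro negligible_countable_Union) (auto intro: countable_rat countable_subset[of _ "\<rat>"])
    moreover have "?N \<subseteq> (\<Union>t\<in>{t \<in> \<rat>. 0 \<le> t \<and> ereal t < T_star u}. ?C t)"
    proof
      fix x assume x: "x \<in> ?N"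
      then obtain z where z: "ereal x < ereal z" "ereal z < T_star u"
        using ereal_dense2[of "ereal x" "T_star u"] by auto
      then obtain q where q: "q \<in> \<rat>" "x < q" "q < z" using Rats_dense_in_real[of x z] by auto
      moreover have "ereal q < T_star u" using q z by (auto intro: less_trans[of _ "ereal z"])
      ultimately show "x \<in> (\<Union>t\<in>{t \<in> \<rat>. 0 \<le> t \<and> ereal t < T_star u}. ?C t)" using x by force
    qed
    ultimately show "negligible ?N" by (rule negligible_subset)
  qed
  finally show ?thesis by (rule sym)
qed

section \<open>Tightness and the inverse of the energy along the curve\<close>

text \<open>
  The domain of the inverse of \<open>t \<mapsto> \<phi> (u t)\<close> in part (6); \<open>lifetime\<close> is its codomain.
\<close>

definition levels :: "(real \<Rightarrow> 'a) \<Rightarrow> real set" where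
  "levels u = {r. (INF x\<in>Rg u. ereal (\<phi> x)) < ereal r \<and> r \<le> \<phi> (u 0)}"

definition lifetime :: "(real \<Rightarrow> 'a) \<Rightarrow> real set" where
  "lifetime u = {t. 0 \<le> t \<and> ereal t < T_star u}"

lemma lifetime_down: "t \<in> lifetime u \<Longrightarrow> 0 \<le> s \<Longrightarrow> s \<le> t \<Longrightarrow> s \<in> lifetime u"
  unfolding lifetime_def using le_less_trans[of "ereal s" "ereal t"] by auto

lemma levels_iff: "r \<in> levels u \<longleftrightarrow> (\<exists>s\<ge>0. \<phi> (u s) < r) \<and> r \<le> \<phi> (u 0)"
  unfolding levels_def Rg_def by (auto simp: INF_less_iff)

lemma energy_in_levels_iff:
  assumes u: "flow u" and t: "0 \<le> t"
  shows "\<phi> (u t) \<in> levels u \<longleftrightarrow> t \<in> lifetime u"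
proof -
  have "(\<exists>s\<ge>0. \<phi> (u s) < \<phi> (u t)) \<longleftrightarrow> \<not> (\<forall>s\<ge>t. u s = u t)"
  proof
    assume "\<exists>s\<ge>0. \<phi> (u s) < \<phi> (u t)"
    then obtain s where s: "0 \<le> s" "\<phi> (u s) < \<phi> (u t)" by blast
    then have "t \<le> s" using energy_antimono[OF u s(1), of t] by (cases "t \<le> s") auto
    moreover have "u s \<noteq> u t" using s by auto
    ultimately show "\<not> (\<forall>s\<ge>t. u s = u t)" by blast
  next
    assume "\<not> (\<forall>s\<ge>t. u s = u t)"
    then obtain s where s: "t \<le> s" "u s \<noteq> u t" by blast
    then have "\<phi> (u s) \<noteq> \<phi> (u t)" using eq_iff_energy_eq[OF u, of s t] t by simp
    then have "\<phi> (u s) < \<phi> (u t)" using energy_antimono[OF u t s(1)] by simp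
    then show "\<exists>s\<ge>0. \<phi> (u s) < \<phi> (u t)" using s t by (intro exI[of _ s]) simp
  qed
  also have "\<dots> \<longleftrightarrow> t \<in> lifetime u"
    using T_star_le_iff_flow[OF u t] t by (auto simp: lifetime_def not_le[symmetric] simp del: not_le)
  finally show ?thesis using energy_antimono[OF u, of 0 t] t by (simp add: levels_iff)
qed

lemma level_attained:
  assumes u: "flow u" and r: "r \<in> levels u"
  obtains t where "t \<in> lifetime u" "\<phi> (u t) = r"
proof -
  obtain s where s: "0 \<le> s" "\<phi> (u s) < r" "r \<le> \<phi> (u 0)" using r by (auto simp: levels_iff)
  then have "r \<in> \<phi> ` u ` {0..s}" using energy_image[OF u s(1)] by simp
  then obtain t where t: "0 \<le> t" "\<phi> (u t) = r" by auto
  then have "t \<in> lifetime u" using energy_in_levels_iff[OF u t(1)] r by simp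
  with t show ?thesis using that by blast
qed

text \<open>
  Split the clock of a tight solution into \<open>smooth_time n u t\<close> and the rest \<open>m t\<close>. The first part
  is Lipschitz in the energy, and \<open>m\<close> is nondecreasing with small total growth when \<open>n\<close> is large,
  so its increments over disjoint intervals have a small sum.
\<close>

lemma tight_inverse_loc_abs_cont:
  assumes u: "flow u" "tight u"
  obtains \<psi> where "\<psi> \<in> levels u \<rightarrow> lifetime u" "loc_abs_cont_on (levels u) \<psi>"
    "\<And>t. t \<in> lifetime u \<Longrightarrow> \<psi> (\<phi> (u t)) = t"
proof -
  define \<psi> where "\<psi> r = (SOME t. t \<in> lifetime u \<and> \<phi> (u t) = r)" for r
  have \<psi>: "\<psi> r \<in> lifetime u" "\<phi> (u (\<psi> r)) = r" if r: "r \<in> levels u" for r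
  proof -
    obtain t where "t \<in> lifetime u \<and> \<phi> (u t) = r" using level_attained[OF u(1) r] by blast
    then have "\<psi> r \<in> lifetime u \<and> \<phi> (u (\<psi> r)) = r" unfolding \<psi>_def by (rule someI)
    then show "\<psi> r \<in> lifetime u" "\<phi> (u (\<psi> r)) = r" by auto
  qed
  have nonneg: "0 \<le> \<psi> r" if "r \<in> levels u" for r using \<psi>(1)[OF that] by (simp add: lifetime_def)
  have inverse: "\<psi> (\<phi> (u t)) = t" if t: "t \<in> lifetime u" for t
  proof -
    have t0: "0 \<le> t" using t by (simp add: lifetime_def)
    have "\<phi> (u t) \<in> levels u" using energy_in_levels_iff[OF u(1) t0] t by simp
    from \<psi>[OF this] show ?thesis using tight_injective[OF u] t by (auto simp: lifetime_def)
  qed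
  have antimono: "\<psi> r' \<le> \<psi> r" if "r \<in> levels u" "r' \<in> levels u" "r \<le> r'" for r r'
  proof (rule ccontr)
    assume "\<not> \<psi> r' \<le> \<psi> r"
    then have "\<phi> (u (\<psi> r')) < \<phi> (u (\<psi> r))"
      using tight_energy_strict[OF u, of "\<psi> r" "\<psi> r'"] \<psi>(1)[OF that(1)] \<psi>(1)[OF that(2)]
      by (simp add: lifetime_def)
    then show False using \<psi>(2) that by simp
  qed
  have "abs_cont_on a b \<psi>" if ab: "a \<le> b" and sub: "{a..b} \<subseteq> levels u" for a b
    unfolding abs_cont_on_def
  proof (intro allI impI)
    fix \<epsilon> :: real assume \<epsilon>: "0 < \<epsilon>"
    define T where "T = \<psi> a"
    have lev: "r \<in> levels u" if "a \<le> r" "r \<le> b" for r using sub that by auto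
    have T: "0 \<le> T" "active_time u T = T"
      using \<psi>(1)[OF lev[of a]] ab u(2) by (auto simp: T_def lifetime_def tight_def)
    have "(\<lambda>n. smooth_time n u T) \<longlonglongrightarrow> T" using active_time_limit(2)[OF u(1) T(1)] T(2) by simp
    then have "\<forall>\<^sub>F n in sequentially. dist (smooth_time n u T) T < \<epsilon> / 2"
      by (rule tendstoD) (use \<epsilon> in simp)
    then obtain n where "dist (smooth_time n u T) T < \<epsilon> / 2"
      using eventually_happens'[OF sequentially_bot] by blast
    then have n: "T - smooth_time n u T < \<epsilon> / 2" unfolding dist_real_def by linarith
    define m where "m t = t - smooth_time n u t" for t
    have m_mono: "m s \<le> m t" if "0 \<le> s" "s \<le> t" for s t
      using smooth_time_increment(2)[OF u(1) that, of n] by (simp add: m_def)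
    \<comment> \<open>\<open>n + 1\<close> instead of \<open>n\<close> because \<open>n\<close> may be \<open>0\<close>\<close>
    define \<delta> where "\<delta> = \<epsilon> / (2 * (real n + 1))"
    have "(\<Sum>(x, y)\<in>P. \<bar>\<psi> y - \<psi> x\<bar>) < \<epsilon>"
      if P: "finite P" "\<forall>(x, y)\<in>P. a \<le> x \<and> x \<le> y \<and> y \<le> b"
        "disjoint_family_on (\<lambda>(x, y). {x<..<y}) P" "(\<Sum>(x, y)\<in>P. y - x) < \<delta>" for P
    proof -
      have "(\<Sum>(x, y)\<in>P. \<bar>\<psi> y - \<psi> x\<bar>) \<le> (\<Sum>(x, y)\<in>P. n * (y - x) + (- m (\<psi> y) - - m (\<psi> x)))"
      proof (rule sum_mono)
        fix p assume "p \<in> P"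
        obtain x y where p: "p = (x, y)" by (cases p)
        then have xy: "a \<le> x" "x \<le> y" "y \<le> b" using P(2) \<open>p \<in> P\<close> by auto
        then have lx: "x \<in> levels u" and ly: "y \<in> levels u" by (auto intro: lev)
        have "smooth_time n u (\<psi> x) - smooth_time n u (\<psi> y) \<le> n * (\<phi> (u (\<psi> y)) - \<phi> (u (\<psi> x)))"
          by (intro smooth_time_increment_le_energy u nonneg antimono lx ly xy)
        then have "\<psi> x - \<psi> y \<le> n * (y - x) + (m (\<psi> x) - m (\<psi> y))"
          using \<psi>(2)[OF lx] \<psi>(2)[OF ly] by (simp add: m_def)
        then show "(case p of (x, y) \<Rightarrow> \<bar>\<psi> y - \<psi> x\<bar>) \<le>
            (case p of (x, y) \<Rightarrow> n * (y - x) + (- m (\<psi> y) - - m (\<psi> x)))"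
          using antimono[OF lx ly xy(2)] p by simp
      qed
      also have "\<dots> = n * (\<Sum>(x, y)\<in>P. y - x) + (\<Sum>(x, y)\<in>P. - m (\<psi> y) - - m (\<psi> x))"
        by (simp add: case_prod_beta sum.distrib sum_distrib_left)
      \<comment> \<open>since \<open>\<psi>\<close> reverses the order, \<open>- m \<circ> \<psi>\<close> is nondecreasing\<close>
      also have "(\<Sum>(x, y)\<in>P. - m (\<psi> y) - - m (\<psi> x)) \<le> - m (\<psi> b) - - m (\<psi> a)"
      proof (rule sum_increments_disjoint_le[OF P(1) _ P(3) ab])
        show "mono_on {a..b} (\<lambda>r. - m (\<psi> r))"
          by (intro mono_onI) (auto intro!: m_mono nonneg antimono lev)
      qed (use P(2) in auto)
      also have "- m (\<psi> b) - - m (\<psi> a) \<le> m T"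
        using m_mono[of 0 "\<psi> b"] nonneg[OF lev[of b]] ab by (simp add: T_def m_def smooth_time_def)
      also have "real n * (\<Sum>(x, y)\<in>P. y - x) \<le> n * \<delta>"
        using P(4) by (intro mult_left_mono) auto
      also have "real n * \<delta> \<le> \<epsilon> / 2" using \<epsilon> by (simp add: \<delta>_def field_simps)
      also have "m T < \<epsilon> / 2" using n by (simp add: m_def)
      finally show ?thesis by simp
    qed
    moreover have "\<delta> > 0" using \<epsilon> by (simp add: \<delta>_def)
    ultimately show "\<exists>\<delta>>0. \<forall>P. finite P \<and> (\<forall>(x, y)\<in>P. a \<le> x \<and> x \<le> y \<and> y \<le> b) \<and>
        disjoint_family_on (\<lambda>(x, y). {x<..<y}) P \<and> (\<Sum>(x, y)\<in>P. y - x) < \<delta> \<longrightarrow>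
        (\<Sum>(x, y)\<in>P. \<bar>\<psi> y - \<psi> x\<bar>) < \<epsilon>" by blast
  qed
  then have "loc_abs_cont_on (levels u) \<psi>" unfolding loc_abs_cont_on_def by blast
  with \<psi>(1) inverse show ?thesis using that by blast
qed

lemma energy_decrease_le:
  assumes u: "flow u" and ab: "0 \<le> a" "a \<le> b" and bound: "\<And>t. t \<in> {a..b} \<Longrightarrow> (norm (g (u t)))\<^sup>2 \<le> \<eta>"
  shows "\<phi> (u a) - \<phi> (u b) \<le> \<eta> * (b - a)"
proof -
  have "\<phi> (u a) + \<eta> * a \<le> \<phi> (u b) + \<eta> * b"
  proof (rule DERIV_nonneg_imp_increasing_open[OF ab(2)])
    fix t assume t: "a < t" "t < b"
    have "((\<lambda>t. \<phi> (u t) + \<eta> * t) has_real_derivative - (norm (g (u t)))\<^sup>2 + \<eta> * 1) (at t)"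
      using t ab by (intro DERIV_add DERIV_cmult DERIV_ident energy_deriv_interior u) auto
    then show "\<exists>y. ((\<lambda>t. \<phi> (u t) + \<eta> * t) has_real_derivative y) (at t) \<and> 0 \<le> y"
      using bound[of t] t by force
  qed (use ab in \<open>auto intro!: continuous_intros energy_continuous u\<close>)
  then show ?thesis by (simp add: algebra_simps)
qed

text \<open>
  Divide \<open>{0..t}\<close> into short intervals of equal length and select those that contain a critical
  time. On them the gradient is small, so the energy drops by little in total, and absolute
  continuity of the inverse makes their total length small. On all other intervals active time
  runs like the clock.
\<close>

lemma tight_if_inverse_loc_abs_cont:
  assumes u: "flow u" and AC: "loc_abs_cont_on (levels u) \<psi>"
    and inverse: "\<And>t. t \<in> lifetime u \<Longrightarrow> \<psi> (\<phi> (u t)) = t"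
  shows "tight u"
  unfolding tight_def
proof (intro allI impI)
  fix t assume t: "0 \<le> t" "ereal t < T_star u"
  then have t_lifetime: "t \<in> lifetime u" by (simp add: lifetime_def)
  define f where "f x = \<phi> (u x)" for x
  have lifetime: "x \<in> lifetime u" if "0 \<le> x" "x \<le> t" for x using lifetime_down[OF t_lifetime that] .
  have strict: "f y < f x" if "0 \<le> x" "x < y" "y \<le> t" for x y
  proof -
    have "f y \<noteq> f x" using inverse[OF lifetime[of x]] inverse[OF lifetime[of y]] that unfolding f_def by force
    then show ?thesis using energy_antimono[OF u that(1), of y] that by (simp add: f_def)
  qed
  have "{f t..f 0} \<subseteq> levels u"
  proof
    fix r assume "r \<in> {f t..f 0}"
    moreover have "f t \<in> levels u" using energy_in_levels_iff[OF u t(1)] t_lifetime by (simp add: f_def)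
    ultimately show "r \<in> levels u" by (force simp: levels_iff f_def)
  qed
  moreover have "f t \<le> f 0" using energy_antimono[OF u, of 0 t] t by (simp add: f_def)
  ultimately have ac: "abs_cont_on (f t) (f 0) \<psi>" using AC unfolding loc_abs_cont_on_def by blast
  have small: "t - active_time u t < \<epsilon>" if \<epsilon>: "0 < \<epsilon>" for \<epsilon>
  proof -
    obtain \<delta> where \<delta>: "\<delta> > 0" and ac': "\<forall>P. finite P \<and>
        (\<forall>(x, y)\<in>P. f t \<le> x \<and> x \<le> y \<and> y \<le> f 0) \<and>
        disjoint_family_on (\<lambda>(x, y). {x<..<y}) P \<and> (\<Sum>(x, y)\<in>P. y - x) < \<delta> \<longrightarrow>
        (\<Sum>(x, y)\<in>P. \<bar>\<psi> y - \<psi> x\<bar>) < \<epsilon>"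
      using ac[unfolded abs_cont_on_def, THEN spec, THEN mp, OF \<epsilon>] by (elim exE conjE)
    \<comment> \<open>chosen such that an energy loss at rate \<open>\<eta>\<close> over \<open>{0..t}\<close> stays below \<open>\<delta>\<close>\<close>
    define \<eta> where "\<eta> = \<delta> / (t + 1)"
    have \<eta>: "\<eta> > 0" using \<delta> t by (simp add: \<eta>_def)
    define q where "q x = (norm (g (u x)))\<^sup>2" for x
    have "continuous_on {0..t} q"
      unfolding q_def
      by (intro continuous_intros continuous_on_compose2[OF cont_g flow_continuous[OF u]]) auto
    then have "uniformly_continuous_on {0..t} q" by (intro compact_uniformly_continuous) auto
    then obtain d where d: "d > 0" "\<And>x y. x \<in> {0..t} \<Longrightarrow> y \<in> {0..t} \<Longrightarrow> dist y x < d \<Longrightarrow> dist (q y) (q x) < \<eta>"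
      unfolding uniformly_continuous_on_def using \<eta> by meson
    obtain N :: nat where N: "t / d < real N" using reals_Archimedean2 by blast
    have N0: "0 < real N" using N t d by (smt (verit) divide_nonneg_pos)
    have mesh: "t / N < d" using N N0 d by (simp add: field_simps)
    define x where "x i = real i * t / N" for i :: nat
    have x_step: "x (Suc i) - x i = t / N" for i
      by (simp add: x_def distrib_right add_divide_distrib)
    have x_0: "x 0 = 0" and x_N: "x N = t" using N0 by (auto simp: x_def)
    have x_mono: "x i \<le> x j" if "i \<le> j" for i j
      unfolding x_def using that t by (intro divide_right_mono mult_right_mono) auto
    have x_nonneg: "0 \<le> x i" for i using x_mono[of 0 i] x_0 by simp
    have x_le: "x i \<le> t" if "i \<le> N" for i using x_mono[OF that] x_N by simp
    define A where "A = {i. i < N \<and> (\<exists>r\<in>{x i..x (Suc i)}. g (u r) = 0)}"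
    have A: "finite A" "\<And>i. i \<in> A \<Longrightarrow> i < N" by (auto simp: A_def)
    define J where "J i = (f (x (Suc i)), f (x i))" for i
    show ?thesis
    proof (cases "t = 0")
      case True
      then show ?thesis using \<epsilon> active_time_0[OF u] by simp
    next
      case False
      then have t_pos: "0 < t" using t by simp
      have x_less: "x i < x j" if "i < j" for i j
        unfolding x_def using that t_pos N0 by (intro divide_strict_right_mono mult_strict_right_mono) auto
      have fx_strict: "f (x j) < f (x i)" if "i < j" "j \<le> N" for i j
        by (intro strict x_nonneg x_less x_le that)
      have fx_anti: "f (x j) \<le> f (x i)" if "i \<le> j" "j \<le> N" for i j
        using fx_strict[of i j] that by (cases "i = j") auto
      have inj: "inj_on J A"
      proof (rule inj_onI)
        fix i j assume ij: "i \<in> A" "j \<in> A" "J i = J j"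
        show "i = j"
          using fx_strict[of i j] fx_strict[of j i] A(2)[OF ij(1)] A(2)[OF ij(2)] ij(3)
          by (cases i j rule: linorder_cases) (auto simp: J_def)
      qed
      have disj: "disjoint_family_on (\<lambda>(x, y). {x<..<y}) (J ` A)"
      proof -
        have sep: "{f (x (Suc i))<..<f (x i)} \<inter> {f (x (Suc j))<..<f (x j)} = {}" if "i < j" "j < N" for i j
          using fx_anti[of "Suc i" j] that by auto
        have "{f (x (Suc i))<..<f (x i)} \<inter> {f (x (Suc j))<..<f (x j)} = {}" if "i \<in> A" "j \<in> A" "i \<noteq> j" for i j
          using sep[of i j] sep[of j i] that A(2) by (cases i j rule: linorder_cases) auto
        then show ?thesis unfolding disjoint_family_on_def J_def by fastforce
      qed
      have small_drop: "f (x i) - f (x (Suc i)) \<le> \<eta> * (t / N)" if i: "i \<in> A" for i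
      proof -
        have iN: "Suc i \<le> N" using A(2)[OF i] by simp
        obtain r where r: "x i \<le> r" "r \<le> x (Suc i)" "g (u r) = 0" using i by (auto simp: A_def)
        have "q s \<le> \<eta>" if s: "s \<in> {x i..x (Suc i)}" for s
        proof -
          have "r \<in> {0..t}" "s \<in> {0..t}" using r s x_nonneg[of i] x_le[OF iN] by auto
          moreover have "dist s r < d" using r s x_step[of i] mesh by (auto simp: dist_real_def)
          ultimately have "dist (q s) (q r) < \<eta>" by (rule d(2))
          then show ?thesis using r by (simp add: q_def dist_real_def)
        qed
        then have "f (x i) - f (x (Suc i)) \<le> \<eta> * (x (Suc i) - x i)"
          unfolding f_def q_def by (intro energy_decrease_le u x_nonneg x_mono) auto
        then show ?thesis by (simp add: x_step)
      qed
      have card: "card A \<le> N" using card_mono[of "{..<N}" A] A by auto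
      have "(\<Sum>(x, y)\<in>J ` A. y - x) = (\<Sum>i\<in>A. f (x i) - f (x (Suc i)))"
        unfolding sum.reindex[OF inj] by (simp add: J_def)
      also have "\<dots> \<le> card A * (\<eta> * (t / N))"
        using sum_bounded_above[of A, OF small_drop] by simp
      also have "\<dots> \<le> N * (\<eta> * (t / N))"
        using card \<eta> t by (intro mult_right_mono) auto
      also have "\<dots> = \<delta> * (t / (t + 1))" using N0 by (simp add: \<eta>_def)
      also have "\<dots> < \<delta> * 1" using \<delta> t by (intro mult_strict_left_mono) auto
      finally have "(\<Sum>(x, y)\<in>J ` A. y - x) < \<delta>" by simp
      then have "(\<Sum>(x, y)\<in>J ` A. \<bar>\<psi> y - \<psi> x\<bar>) < \<epsilon>"
      proof (intro ac'[THEN spec, THEN mp] conjI disj)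
        show "\<forall>(r, s)\<in>J ` A. f t \<le> r \<and> r \<le> s \<and> s \<le> f 0"
        proof (clarify, unfold J_def prod.inject, elim conjE)
          fix r s i assume i: "i \<in> A" and rs: "r = f (x (Suc i))" "s = f (x i)"
          then have "i < N" using A(2) by simp
          then show "f t \<le> r \<and> r \<le> s \<and> s \<le> f 0"
            using fx_anti[of "Suc i" N] fx_anti[of i "Suc i"] fx_anti[of 0 i]
            by (simp add: rs x_0 x_N)
        qed
      qed (use A in auto)
      also have "(\<Sum>(x, y)\<in>J ` A. \<bar>\<psi> y - \<psi> x\<bar>) = (\<Sum>i\<in>A. \<bar>\<psi> (f (x i)) - \<psi> (f (x (Suc i)))\<bar>)"
        unfolding sum.reindex[OF inj] by (simp add: J_def)
      also have "\<dots> = (\<Sum>i\<in>A. x (Suc i) - x i)"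
      proof (rule sum.cong)
        fix i assume "i \<in> A"
        then have iN: "Suc i \<le> N" using A(2) by force
        have "\<psi> (f (x i)) = x i" "\<psi> (f (x (Suc i))) = x (Suc i)"
          unfolding f_def using iN by (auto intro!: inverse lifetime x_nonneg x_le)
        then show "\<bar>\<psi> (f (x i)) - \<psi> (f (x (Suc i)))\<bar> = x (Suc i) - x i" using x_mono[of i "Suc i"] by simp
      qed simp
      finally have lt: "(\<Sum>i\<in>A. x (Suc i) - x i) < \<epsilon>" .
      \<comment> \<open>\<open>m\<close> is the idle time; it does not grow on intervals without critical times\<close>
      define m where "m r = r - active_time u r" for r
      have "t - active_time u t = m (x N) - m (x 0)" by (simp add: m_def x_N x_0 active_time_0[OF u])
      also have "\<dots> = (\<Sum>i<N. m (x (Suc i)) - m (x i))" by (rule sum_lessThan_telescope[symmetric])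
      also have "\<dots> = (\<Sum>i\<in>A. m (x (Suc i)) - m (x i))"
      proof (rule sum.mono_neutral_right)
        show "\<forall>i\<in>{..<N} - A. m (x (Suc i)) - m (x i) = 0"
        proof
          fix i assume i: "i \<in> {..<N} - A"
          have "active_time u (x (Suc i)) - active_time u (x i) = x (Suc i) - x i"
            by (intro active_time_no_critical u x_nonneg x_mono) (use i in \<open>auto simp: A_def\<close>)
          then show "m (x (Suc i)) - m (x i) = 0" by (simp add: m_def)
        qed
      qed (use A in auto)
      also have "\<dots> \<le> (\<Sum>i\<in>A. x (Suc i) - x i)"
      proof (rule sum_mono)
        fix i
        show "m (x (Suc i)) - m (x i) \<le> x (Suc i) - x i"
          using active_time_mono[OF u x_nonneg[of i] x_mono[of i "Suc i"]] by (simp add: m_def)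
      qed
      finally show ?thesis using lt by simp
    qed
  qed
  have "t \<le> active_time u t"
  proof (rule field_le_epsilon)
    fix e :: real assume "0 < e"
    then show "t \<le> active_time u t + e" using small[of e] by simp
  qed
  then show "active_time u t = t" using active_time_bounds[OF u t(1)] by simp
qed

section \<open>Solutions as extensional curves\<close>

lemma grad_eq: "grad \<phi> x = g x"
  unfolding grad_def by (rule the_equality) (use gderiv gderiv_unique in blast)+

lemma GF_iff: "u \<in> GF \<phi> \<longleftrightarrow> u \<in> extensional {0..} \<and> flow u"
proof
  assume "u \<in> GF \<phi>"
  then show "u \<in> extensional {0..} \<and> flow u" by (auto simp: GF_def flow_def grad_eq)
next
  assume u: "u \<in> extensional {0..} \<and> flow u"
  have "continuous_on {0..} (\<lambda>t. - g (u t))"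
    using u by (intro continuous_intros continuous_on_compose2[OF cont_g flow_continuous]) auto
  then show "u \<in> GF \<phi>"
    using u unfolding GF_def by (auto simp: flow_def grad_eq intro!: exI[of _ "\<lambda>t. - g (u t)"])
qed

lemma GF_flow: "u \<in> GF \<phi> \<Longrightarrow> flow u"
  by (simp add: GF_iff)

lemma GF_eqI:
  assumes "u \<in> GF \<phi>" "v \<in> GF \<phi>" "\<And>t. 0 \<le> t \<Longrightarrow> u t = v t"
  shows "u = v"
  using assms by (intro extensionalityI[of u "{0..}" v]) (auto simp: GF_iff)

text \<open>
  A truncated solution agrees at each time with a full solution at a possibly earlier time, which
  reduces statements on \<open>TGF\<close> to initial pieces of solutions.
\<close>

lemma TGF_prefix:
  assumes v: "v \<in> TGF \<phi>" and t: "0 \<le> t"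
  obtains w b where "flow w" "w 0 = v 0" "0 \<le> b" "b \<le> t" "w b = v t" "w ` {0..b} \<subseteq> Rg v"
proof -
  consider "v \<in> GF \<phi>" | w T where "w \<in> GF \<phi>" "0 \<le> T" "v = restrict (\<lambda>t. w (min t T)) {0..}"
    using v unfolding TGF_def by blast
  then show ?thesis
  proof cases
    case 1
    show ?thesis by (rule that[of v t]) (use 1 t in \<open>auto simp: GF_flow Rg_def\<close>)
  next
    case (2 w T)
    have "w ` {0..min t T} \<subseteq> Rg v"
    proof
      fix z assume "z \<in> w ` {0..min t T}"
      then obtain s where "0 \<le> s" "s \<le> T" "z = w s" by auto
      then have "z = v s" using 2(3) by simp
      then show "z \<in> Rg v" using \<open>0 \<le> s\<close> by (auto simp: Rg_def)
    qed
    then show ?thesis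
      by (intro that[of w "min t T"]) (use 2 t in \<open>auto simp: GF_flow\<close>)
  qed
qed

end

section \<open>Reparametrisation by active time\<close>

locale bounded_energy = C1_energy +
  fixes \<tau> c :: real
  assumes \<tau>_pos: "\<tau> > 0" and energy_lower: "- c \<le> 1 / (2 * \<tau>) * (norm x)\<^sup>2 + \<phi> x"
begin

text \<open>
  Let \<open>r\<close> be so late that the remaining active time is below \<open>\<tau> / 4\<close>. The squared
  displacement after \<open>r\<close> is then at most \<open>\<tau> / 4\<close> times the energy loss, which by the lower
  bound on \<open>\<phi>\<close> grows at most like \<open>(norm (y t))\<^sup>2 / (2 * \<tau>)\<close>. This is absorbed, so the
  curve and its energy stay bounded, and the displacement estimate gives the Cauchy property. At a
  limit that is not critical active time would grow at unit rate for ever.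
\<close>

lemma flow_converges_if_active_time_bounded:
  assumes y: "flow y" and B: "\<And>t. 0 \<le> t \<Longrightarrow> active_time y t \<le> B"
  obtains x where "(y \<longlongrightarrow> x) at_top" "g x = 0"
proof -
  let ?s = "active_time y"
  define M where "M = Sup (?s ` {0..})"
  have bdd: "bdd_above (?s ` {0..})" using B by (auto simp: bdd_above_def)
  have s_le: "?s t \<le> M" if "0 \<le> t" for t
    unfolding M_def by (rule cSup_upper[OF _ bdd]) (use that in auto)
  have near: "\<exists>r\<ge>0. M - e < ?s r" if "0 < e" for e
    using less_cSup_iff[OF _ bdd, of "M - e"] that by (auto simp: M_def)
  obtain r where r: "0 \<le> r" "M - \<tau> / 4 < ?s r" using near[of "\<tau> / 4"] \<tau>_pos by auto
  define K where "K = (norm (y r))\<^sup>2"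
  \<comment> \<open>\<open>L - c\<close> is the bound on \<open>(norm (y t))\<^sup>2 / (2 * \<tau>)\<close> that absorption leaves below\<close>
  define L where "L = c + ((\<phi> (y r) + c) / 3 + 4 * K / (3 * \<tau>))"
  have late: "- L \<le> \<phi> (y t)" if t: "r \<le> t" for t
  proof -
    define Q where "Q = (norm (y t))\<^sup>2"
    have s: "?s t - ?s r \<le> \<tau> / 4" using s_le[of t] r t by simp
    have D: "0 \<le> \<phi> (y r) - \<phi> (y t)" using energy_antimono[OF y r(1) t] by simp
    have low: "- c \<le> 1 / (2 * \<tau>) * Q + \<phi> (y t)" unfolding Q_def by (rule energy_lower)
    have "(norm (y t - y r))\<^sup>2 \<le> \<tau> / 4 * (\<phi> (y r) - \<phi> (y t))"
      using displacement_sq_le[OF y r(1) t] mult_right_mono[OF s D] by simp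
    also have "\<dots> \<le> \<tau> / 4 * (\<phi> (y r) + c + 1 / (2 * \<tau>) * Q)"
      using low \<tau>_pos by (intro mult_left_mono) auto
    also have "\<dots> = \<tau> / 4 * (\<phi> (y r) + c) + Q / 8" using \<tau>_pos by (simp add: field_simps)
    finally have 1: "(norm (y t - y r))\<^sup>2 \<le> \<tau> / 4 * (\<phi> (y r) + c) + Q / 8" .
    have "(norm (y t))\<^sup>2 \<le> (norm (y t - y r) + norm (y r))\<^sup>2"
      by (intro power_mono norm_ge_zero) (metis diff_add_cancel norm_triangle_ineq)
    also have "\<dots> \<le> 2 * (norm (y t - y r))\<^sup>2 + 2 * (norm (y r))\<^sup>2"
      using sum_squares_bound[of "norm (y t - y r)" "norm (y r)"] by (simp add: power2_sum)
    finally have "Q \<le> 2 * (norm (y t - y r))\<^sup>2 + 2 * K" by (simp add: Q_def K_def)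
    with 1 have "3 / 4 * Q \<le> \<tau> / 2 * (\<phi> (y r) + c) + 2 * K" by argo
    then have "1 / (2 * \<tau>) * (4 / 3) * (3 / 4 * Q) \<le>
        1 / (2 * \<tau>) * (4 / 3) * (\<tau> / 2 * (\<phi> (y r) + c) + 2 * K)"
      using \<tau>_pos by (intro mult_left_mono) auto
    also have "\<dots> = L - c" using \<tau>_pos by (simp add: L_def field_simps)
    finally have "1 / (2 * \<tau>) * Q \<le> L - c" by simp
    with low show ?thesis by linarith
  qed
  have low: "- L \<le> \<phi> (y t)" if "0 \<le> t" for t
    using late[of t] late[of r] energy_antimono[OF y that, of r] by (cases "r \<le> t") auto
  define D where "D = \<phi> (y 0) + L"
  have D: "0 \<le> D" using low[of 0] by (simp add: D_def)
  have close: "\<exists>a\<ge>0. \<forall>b\<ge>a. norm (y b - y a) < e" if "0 < e" for e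
  proof -
    \<comment> \<open>\<open>D + 1\<close> keeps the quotient defined when no energy is left to lose\<close>
    have "0 < e\<^sup>2 / (D + 1)" using that D by simp
    then obtain a where a: "0 \<le> a" "M - e\<^sup>2 / (D + 1) < ?s a" using near by blast
    have "norm (y b - y a) < e" if b: "a \<le> b" for b
    proof -
      have "(norm (y b - y a))\<^sup>2 \<le> (?s b - ?s a) * (\<phi> (y a) - \<phi> (y b))"
        by (rule displacement_sq_le[OF y a(1) b])
      also have "\<dots> \<le> (?s b - ?s a) * (D + 1)"
        using energy_antimono[OF y _ a(1)] low[of b] a b active_time_increment[OF y a(1) b]
        by (intro mult_left_mono) (auto simp: D_def)
      also have "\<dots> < e\<^sup>2 / (D + 1) * (D + 1)"
        using s_le[of b] a b D by (intro mult_strict_right_mono) auto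
      finally have "(norm (y b - y a))\<^sup>2 < e\<^sup>2" using D by simp
      then show ?thesis using \<open>0 < e\<close> by (simp add: power2_less_imp_less)
    qed
    with a show ?thesis by blast
  qed
  have "Cauchy (\<lambda>n. y (real n))"
  proof (rule CauchyI)
    fix e :: real assume "0 < e"
    then obtain a where a: "a \<ge> 0" "\<And>b. b \<ge> a \<Longrightarrow> norm (y b - y a) < e / 2"
      using close[of "e / 2"] by auto
    have "norm (y (real m) - y (real n)) < e" if "m \<ge> nat \<lceil>a\<rceil>" "n \<ge> nat \<lceil>a\<rceil>" for m n
    proof -
      have "a \<le> real m" "a \<le> real n" using that by linarith+
      then have "norm (y (real m) - y a) < e / 2" "norm (y (real n) - y a) < e / 2" using a(2) by blast+
      then show ?thesis by (rule norm_triangle_half_l)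
    qed
    then show "\<exists>N. \<forall>m\<ge>N. \<forall>n\<ge>N. norm (y (real m) - y (real n)) < e" by blast
  qed
  then obtain x where x: "(\<lambda>n. y (real n)) \<longlonglongrightarrow> x" using Cauchy_convergent_iff convergent_def by blast
  have lim: "(y \<longlongrightarrow> x) at_top"
  proof (rule tendstoI)
    fix e :: real assume "0 < e"
    then obtain a where a: "a \<ge> 0" "\<And>b. b \<ge> a \<Longrightarrow> norm (y b - y a) < e / 2"
      using close[of "e / 2"] by auto
    have "(\<lambda>n. norm (y (real n) - y a)) \<longlonglongrightarrow> norm (x - y a)" by (intro tendsto_intros x)
    then have "norm (x - y a) \<le> e / 2"
    proof (rule LIMSEQ_le_const2)
      have "norm (y (real n) - y a) \<le> e / 2" if "n \<ge> nat \<lceil>a\<rceil>" for n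
        using a(2)[of "real n"] that by linarith
      then show "\<exists>N. \<forall>n\<ge>N. norm (y (real n) - y a) \<le> e / 2" by blast
    qed
    have "dist (y b) x < e" if "b \<ge> a" for b
    proof -
      have "norm (y b - x) \<le> norm (y b - y a) + norm (x - y a)"
        using norm_triangle_ineq4[of "y b - y a" "x - y a"] by simp
      also have "\<dots> < e" using a(2)[OF that] \<open>norm (x - y a) \<le> e / 2\<close> by linarith
      finally show ?thesis by (simp add: dist_norm)
    qed
    then show "\<forall>\<^sub>F b in at_top. dist (y b) x < e" unfolding eventually_at_top_linorder by blast
  qed
  have "g x = 0"
  proof (rule ccontr)
    assume "g x \<noteq> 0"
    have "((\<lambda>t. g (y t)) \<longlongrightarrow> g x) at_top"
      using continuous_on_tendsto_compose[OF cont_g lim] by simp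
    then have "\<forall>\<^sub>F t in at_top. g (y t) \<noteq> 0"
      using \<open>g x \<noteq> 0\<close> by (rule tendsto_imp_eventually_ne)
    then obtain N where N: "\<And>t. t \<ge> N \<Longrightarrow> g (y t) \<noteq> 0" unfolding eventually_at_top_linorder by blast
    define a where "a = max N 0"
    define b where "b = a + \<bar>B\<bar> + 1"
    have "?s b - ?s a = b - a" by (rule active_time_no_critical[OF y]) (use N in \<open>auto simp: a_def b_def\<close>)
    then show False using B[of b] active_time_bounds[OF y, of a] by (auto simp: b_def a_def)
  qed
  with lim show ?thesis by (rule that)
qed

text \<open>
  The curve \<open>y\<close> as a function of its active time. At values beyond the total active time the
  curve rests at the limit of \<open>y\<close>.
\<close>

definition reduced :: "(real \<Rightarrow> 'a) \<Rightarrow> real \<Rightarrow> 'a" where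
  "reduced y = restrict (\<lambda>\<sigma>. if \<sigma> \<in> active_time y ` {0..}
      then y (SOME t. 0 \<le> t \<and> active_time y t = \<sigma>) else Lim at_top y) {0..}"

lemma reduced_extensional: "reduced y \<in> extensional {0..}"
  by (simp add: reduced_def)

context
  fixes y assumes y: "flow y"
begin

lemma reduced_active_time:
  assumes "0 \<le> t"
  shows "reduced y (active_time y t) = y t"
proof -
  let ?P = "\<lambda>r. 0 \<le> r \<and> active_time y r = active_time y t"
  have "?P (Eps ?P)" by (rule someI[of ?P t]) (use assms in simp)
  then have "y (Eps ?P) = y t"
    using eq_if_active_time_eq[OF y, of t "Eps ?P"] eq_if_active_time_eq[OF y, of "Eps ?P" t] assms
    by (cases "t \<le> Eps ?P") auto
  then show ?thesis using assms active_time_bounds[OF y assms] by (simp add: reduced_def)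
qed

lemma active_time_image: "0 \<le> t \<Longrightarrow> active_time y ` {0..t} = {0..active_time y t}"
proof
  assume t: "0 \<le> t"
  show "active_time y ` {0..t} \<subseteq> {0..active_time y t}"
    using active_time_bounds[OF y] active_time_mono[OF y] by auto
  show "{0..active_time y t} \<subseteq> active_time y ` {0..t}"
  proof
    fix \<sigma> assume "\<sigma> \<in> {0..active_time y t}"
    then show "\<sigma> \<in> active_time y ` {0..t}"
      using IVT'[of "active_time y" 0 \<sigma> t] active_time_continuous[OF y, of "{0..t}"] t
        active_time_0[OF y] by auto
  qed
qed

lemma beyond_active_time:
  assumes "0 \<le> \<sigma>" "\<sigma> \<notin> active_time y ` {0..}"
  shows "\<And>t. 0 \<le> t \<Longrightarrow> active_time y t < \<sigma>"
    and "(y \<longlongrightarrow> reduced y \<sigma>) at_top" and "g (reduced y \<sigma>) = 0"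
proof -
  show lt: "active_time y t < \<sigma>" if "0 \<le> t" for t
  proof (rule ccontr)
    assume "\<not> active_time y t < \<sigma>"
    then have "\<sigma> \<in> active_time y ` {0..t}" using active_time_image[OF that] assms(1) by simp
    then show False using assms(2) by auto
  qed
  obtain x where x: "(y \<longlongrightarrow> x) at_top" "g x = 0"
    by (rule flow_converges_if_active_time_bounded[OF y less_imp_le[OF lt]])
  have "reduced y \<sigma> = x"
    using assms tendsto_Lim[OF _ x(1)] by (simp add: reduced_def)
  with x show "(y \<longlongrightarrow> reduced y \<sigma>) at_top" and "g (reduced y \<sigma>) = 0" by auto
qed

text \<open>
  The active times of \<open>y\<close> form an interval that starts at \<open>0\<close>; either end of \<open>{a..b}\<close> may lie
  beyond it.
\<close>

lemma reduced_cases: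
  assumes ab: "0 \<le> a" "a \<le> b"
  obtains (active) r t where "0 \<le> r" "r \<le> t" "a = active_time y r" "b = active_time y t"
  | (mixed) r where "0 \<le> r" "a = active_time y r" "b \<notin> active_time y ` {0..}"
  | (beyond) "a \<notin> active_time y ` {0..}" "b \<notin> active_time y ` {0..}"
proof (cases "b \<in> active_time y ` {0..}")
  case True
  then obtain t where t: "0 \<le> t" "b = active_time y t" by auto
  then obtain r where "0 \<le> r" "r \<le> t" "a = active_time y r"
    using active_time_image[OF t(1)] ab by (metis atLeastAtMost_iff imageE)
  with t show ?thesis using active by blast
next
  case False
  then show ?thesis using mixed beyond by (cases "a \<in> active_time y ` {0..}") auto
qed

text \<open>
  This is the differential equation in integrated form. Within the active times it is the
  displacement estimate for \<open>y\<close>; when \<open>b\<close> lies beyond them it is a limit of such estimates along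
  \<open>y\<close>, where the excess is harmless because \<open>reduced y b\<close> is critical and thus
  \<open>norm w \<le> \<epsilon>\<close>.
\<close>

lemma reduced_displacement_estimate:
  assumes ab: "0 \<le> a" "a \<le> b" and w: "\<And>\<sigma>. \<sigma> \<in> {a..b} \<Longrightarrow> norm (g (reduced y \<sigma>) - w) \<le> \<epsilon>"
  shows "norm (reduced y b - reduced y a + (b - a) *\<^sub>R w) \<le> \<epsilon> * (b - a)"
proof -
  have est: "norm (y t - y r + (active_time y t - active_time y r) *\<^sub>R w)
      \<le> \<epsilon> * (active_time y t - active_time y r)"
    if rt: "0 \<le> r" "r \<le> t" "a = active_time y r" "active_time y t \<le> b" for r t
  proof (rule displacement_estimate[OF y rt(1,2)])
    fix x assume "x \<in> {r..t}"
    then show "norm (g (y x) - w) \<le> \<epsilon>"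
      using w[of "active_time y x"] reduced_active_time[of x]
        active_time_mono[OF y, of r x] active_time_mono[OF y, of x t] rt by simp
  qed
  from ab show ?thesis
  proof (cases rule: reduced_cases)
    case (active r t)
    then show ?thesis using est[of r t] reduced_active_time by simp
  next
    case (mixed r)
    have b: "0 \<le> b" using ab by simp
    note beyond = beyond_active_time[OF b mixed(3)]
    have w_le: "norm w \<le> \<epsilon>" using w[of b] ab beyond(3) by simp
    have "((\<lambda>t. norm (y t - y r + (b - a) *\<^sub>R w)) \<longlongrightarrow> norm (reduced y b - y r + (b - a) *\<^sub>R w)) at_top"
      by (intro tendsto_intros beyond)
    then have "norm (reduced y b - y r + (b - a) *\<^sub>R w) \<le> \<epsilon> * (b - a)"
    proof (rule tendsto_upperbound)
      show "\<forall>\<^sub>F t in at_top. norm (y t - y r + (b - a) *\<^sub>R w) \<le> \<epsilon> * (b - a)"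
        using eventually_ge_at_top[of r]
      proof eventually_elim
        case (elim t)
        let ?s = "active_time y t"
        have lt: "?s < b" using beyond(1)[of t] mixed(1) elim by simp
        have "y t - y r + (b - a) *\<^sub>R w = (y t - y r + (?s - a) *\<^sub>R w) + (b - ?s) *\<^sub>R w"
          by (simp add: algebra_simps)
        also have "norm \<dots> \<le> \<epsilon> * (?s - a) + (b - ?s) * \<epsilon>"
        proof (rule norm_triangle_mono)
          show "norm (y t - y r + (?s - a) *\<^sub>R w) \<le> \<epsilon> * (?s - a)"
            using est[of r t] mixed elim lt by simp
          show "norm ((b - ?s) *\<^sub>R w) \<le> (b - ?s) * \<epsilon>"
            using lt w_le by (simp add: mult_left_mono)
        qed
        finally show ?case by (simp add: algebra_simps)
      qed
    qed simp
    then show ?thesis using mixed reduced_active_time by simp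
  next
    case beyond
    have a': "(y \<longlongrightarrow> reduced y a) at_top" and b': "(y \<longlongrightarrow> reduced y b) at_top" and gb: "g (reduced y b) = 0"
      using beyond_active_time[of a] beyond_active_time[of b] beyond ab by auto
    then have "reduced y a = reduced y b" using tendsto_unique[of at_top y] by simp
    moreover have "(b - a) * norm w \<le> (b - a) * \<epsilon>"
      using w[of b] ab gb by (intro mult_left_mono) auto
    ultimately show ?thesis using ab by (simp add: mult.commute)
  qed
qed

text \<open>
  The same case distinction carries the quadratic estimate over; it yields both the monotonicity
  of the energy and the continuity of the reduced curve.
\<close>

lemma reduced_displacement_sq_le:
  assumes ab: "0 \<le> a" "a \<le> b"
  shows "(norm (reduced y b - reduced y a))\<^sup>2 \<le> (b - a) * (\<phi> (reduced y a) - \<phi> (reduced y b))"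
  using ab
proof (cases rule: reduced_cases)
  case (active r t)
  then show ?thesis using displacement_sq_le[OF y, of r t] reduced_active_time by simp
next
  case (mixed r)
  have b: "0 \<le> b" using ab by simp
  note beyond = beyond_active_time[OF b mixed(3)]
  have "((\<lambda>t. \<phi> (y t)) \<longlongrightarrow> \<phi> (reduced y b)) at_top"
    using continuous_on_tendsto_compose[OF continuous_on_\<phi>[of UNIV] beyond(2)] by simp
  then have rhs: "((\<lambda>t. (b - a) * (\<phi> (y r) - \<phi> (y t))) \<longlongrightarrow> (b - a) * (\<phi> (y r) - \<phi> (reduced y b))) at_top"
    by (intro tendsto_intros)
  have lhs: "((\<lambda>t. (norm (y t - y r))\<^sup>2) \<longlongrightarrow> (norm (reduced y b - y r))\<^sup>2) at_top"
    by (intro tendsto_intros beyond)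
  have "\<forall>\<^sub>F t in at_top. (norm (y t - y r))\<^sup>2 \<le> (b - a) * (\<phi> (y r) - \<phi> (y t))"
    using eventually_ge_at_top[of r]
  proof eventually_elim
    case (elim t)
    have "active_time y t - a \<le> b - a" using beyond(1)[of t] mixed(1) elim by simp
    then have "(active_time y t - a) * (\<phi> (y r) - \<phi> (y t)) \<le> (b - a) * (\<phi> (y r) - \<phi> (y t))"
      using energy_antimono[OF y mixed(1) elim] by (intro mult_right_mono) auto
    then show ?case using displacement_sq_le[OF y mixed(1) elim] mixed(2) by simp
  qed
  from tendsto_le[OF _ rhs lhs this] show ?thesis using mixed reduced_active_time by simp
next
  case beyond
  have "(y \<longlongrightarrow> reduced y a) at_top" "(y \<longlongrightarrow> reduced y b) at_top"
    using beyond_active_time[of a] beyond_active_time[of b] beyond ab by auto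
  then have "reduced y a = reduced y b" using tendsto_unique[of at_top y] by simp
  then show ?thesis by simp
qed

lemma reduced_energy_antimono:
  assumes "0 \<le> a" "a \<le> b"
  shows "\<phi> (reduced y b) \<le> \<phi> (reduced y a)"
proof (cases "a = b")
  case False
  have "0 \<le> (b - a) * (\<phi> (reduced y a) - \<phi> (reduced y b))"
    using reduced_displacement_sq_le[OF assms] by (meson order_trans zero_le_power2)
  then show ?thesis using False assms by (simp add: zero_le_mult_iff)
qed simp

lemma reduced_continuous: "continuous_on {0..} (reduced y)"
  unfolding continuous_on_iff
proof (intro ballI allI impI)
  fix a e :: real assume a: "a \<in> {0..}" and e: "0 < e"
  \<comment> \<open>a bound for the energy loss on \<open>{0..a + 1}\<close>, made positive by adding \<open>1\<close>\<close>
  define K where "K = \<phi> (reduced y 0) - \<phi> (reduced y (a + 1)) + 1"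
  have K: "0 < K" using reduced_energy_antimono[of 0 "a + 1"] a by (simp add: K_def)
  have sq: "(norm (reduced y s - reduced y r))\<^sup>2 \<le> (s - r) * K" if "0 \<le> r" "r \<le> s" "s \<le> a + 1" for r s
  proof -
    have "(s - r) * (\<phi> (reduced y r) - \<phi> (reduced y s)) \<le> (s - r) * K"
      using reduced_energy_antimono[of 0 r] reduced_energy_antimono[of s "a + 1"] that
      by (intro mult_left_mono) (auto simp: K_def)
    then show ?thesis using reduced_displacement_sq_le[OF that(1,2)] by simp
  qed
  have "dist (reduced y b) (reduced y a) < e" if b: "0 \<le> b" "dist b a < min 1 (e\<^sup>2 / K)" for b
  proof -
    have "(norm (reduced y b - reduced y a))\<^sup>2 \<le> \<bar>b - a\<bar> * K"
    proof (cases "a \<le> b")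
      case True then show ?thesis using sq[of a b] a b by (simp add: dist_real_def)
    next
      case False
      then show ?thesis using sq[of b a] a b
        by (simp add: dist_real_def norm_minus_commute[of "reduced y b"])
    qed
    also have "\<dots> < e\<^sup>2 / K * K" using b K by (intro mult_strict_right_mono) (auto simp: dist_real_def)
    finally have "(norm (reduced y b - reduced y a))\<^sup>2 < e\<^sup>2" using K by simp
    then show ?thesis using e by (simp add: power2_less_imp_less dist_norm)
  qed
  then show "\<exists>d>0. \<forall>b\<in>{0..}. dist b a < d \<longrightarrow> dist (reduced y b) (reduced y a) < e"
    using e K by (intro exI[of _ "min 1 (e\<^sup>2 / K)"]) auto
qed

lemma reduced_flow: "flow (reduced y)"
  unfolding flow_def has_vector_derivative_def has_derivative_within_alt
proof (intro allI impI conjI)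
  fix a :: real assume a: "0 \<le> a"
  let ?v = "reduced y" and ?w = "g (reduced y a)"
  show "bounded_linear (\<lambda>h. h *\<^sub>R - ?w)" by (rule bounded_linear_scaleR_left)
  fix e :: real assume e: "0 < e"
  have "continuous_on {0..} (\<lambda>\<sigma>. g (?v \<sigma>))"
    by (rule continuous_on_compose2[OF cont_g reduced_continuous]) auto
  then have "\<exists>d>0. \<forall>\<sigma>\<in>{0..}. dist \<sigma> a < d \<longrightarrow> dist (g (?v \<sigma>)) ?w < e"
    unfolding continuous_on_iff using a e by blast
  then obtain d where d: "d > 0" "\<And>\<sigma>. 0 \<le> \<sigma> \<Longrightarrow> dist \<sigma> a < d \<Longrightarrow> dist (g (?v \<sigma>)) ?w < e"
    by auto
  have "norm (?v b - ?v a - (b - a) *\<^sub>R - ?w) \<le> e * norm (b - a)" if b: "0 \<le> b" "norm (b - a) < d" for b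
  proof (cases "a \<le> b")
    case True
    have "norm (?v b - ?v a + (b - a) *\<^sub>R ?w) \<le> e * (b - a)"
      using d(2) b True a
      by (intro reduced_displacement_estimate) (auto simp: dist_norm intro!: less_imp_le)
    then show ?thesis using True by simp
  next
    case False
    have "norm (?v a - ?v b + (a - b) *\<^sub>R ?w) \<le> e * (a - b)"
      using d(2) b False a
      by (intro reduced_displacement_estimate) (auto simp: dist_norm intro!: less_imp_le)
    moreover have "?v b - ?v a - (b - a) *\<^sub>R - ?w = - (?v a - ?v b + (a - b) *\<^sub>R ?w)"
      by (simp add: algebra_simps)
    ultimately show ?thesis using False by (simp only: norm_minus_cancel) simp
  qed
  then show "\<exists>d>0. \<forall>b\<in>{0..}. norm (b - a) < d \<longrightarrow>
      norm (?v b - ?v a - (b - a) *\<^sub>R - ?w) \<le> e * norm (b - a)"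
    using d(1) by auto
qed

lemma reduced_range: "Rg y \<subseteq> Rg (reduced y)" "Rg (reduced y) \<subseteq> closure (Rg y)"
proof -
  show "Rg y \<subseteq> Rg (reduced y)"
  proof
    fix x assume "x \<in> Rg y"
    then obtain t where t: "0 \<le> t" "x = y t" by (auto simp: Rg_def)
    then have "x = reduced y (active_time y t)" by (simp add: reduced_active_time)
    then show "x \<in> Rg (reduced y)" using active_time_bounds[OF y t(1)] by (auto simp: Rg_def)
  qed
  show "Rg (reduced y) \<subseteq> closure (Rg y)"
  proof
    fix x assume "x \<in> Rg (reduced y)"
    then obtain \<sigma> where \<sigma>: "0 \<le> \<sigma>" "x = reduced y \<sigma>" by (auto simp: Rg_def)
    show "x \<in> closure (Rg y)"
    proof (cases "\<sigma> \<in> active_time y ` {0..}")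
      case True
      then obtain t where "0 \<le> t" "\<sigma> = active_time y t" by auto
      then have "x \<in> Rg y" using \<sigma> reduced_active_time by (auto simp: Rg_def)
      then show ?thesis using closure_subset by blast
    next
      case False
      have ev: "\<forall>\<^sub>F t in at_top. y t \<in> closure (Rg y)"
        using eventually_ge_at_top[of 0]
        by eventually_elim (use closure_subset[of "Rg y"] in \<open>auto simp: Rg_def\<close>)
      show ?thesis unfolding \<sigma>(2)
        by (rule Lim_in_closed_set[OF closed_closure ev _ beyond_active_time(2)[OF \<sigma>(1) False]]) simp
    qed
  qed
qed

lemma succeeds_reduced: "y \<succ> reduced y"
  unfolding succeeds_def
  using reduced_range reduced_active_time active_time_bounds[OF y] active_time_increment[OF y]
    active_time_0[OF y]
  by (intro conjI exI[of _ "active_time y"]) auto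

text \<open>
  Active time is intrinsic, so \<open>reduced y\<close> needs active time \<open>active_time y t\<close> to reach \<open>y t\<close>,
  and it is there exactly at this time. Beyond the active times of \<open>y\<close> it has stopped.
\<close>

lemma reduced_tight: "tight (reduced y)"
  unfolding tight_def
proof (intro allI impI)
  fix \<sigma> assume \<sigma>: "0 \<le> \<sigma>" "ereal \<sigma> < T_star (reduced y)"
  show "active_time (reduced y) \<sigma> = \<sigma>"
  proof (cases "\<sigma> \<in> active_time y ` {0..}")
    case True
    then obtain t where t: "0 \<le> t" "\<sigma> = active_time y t" by auto
    have "active_time y t = active_time (reduced y) \<sigma>"
    proof (rule active_time_intrinsic[OF y reduced_flow t(1) \<sigma>(1)])
      show "y 0 = reduced y 0" using reduced_active_time[of 0] active_time_0[OF y] by simp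
      show "y t = reduced y \<sigma>" using reduced_active_time[OF t(1)] t(2) by simp
      show "reduced y ` {0..\<sigma>} \<subseteq> y ` {0..t}"
        unfolding t(2) active_time_image[OF t(1), symmetric] using reduced_active_time by auto
    qed
    then show ?thesis using t by simp
  next
    case False
    have "reduced y s = reduced y \<sigma>" if "\<sigma> \<le> s" for s
    proof -
      have s: "0 \<le> s" using that \<sigma> by simp
      have "s \<notin> active_time y ` {0..}" using beyond_active_time(1)[OF \<sigma>(1) False] that by force
      from beyond_active_time(2)[OF s this] beyond_active_time(2)[OF \<sigma>(1) False]
      show ?thesis using tendsto_unique[of at_top y] by simp
    qed
    then have "T_star (reduced y) \<le> ereal \<sigma>" using T_star_le_iff_flow[OF reduced_flow \<sigma>(1)] by blast
    with \<sigma>(2) show ?thesis by simp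
  qed
qed

end

section \<open>Minimal solutions\<close>

lemma reduced_GF: "y \<in> GF \<phi> \<Longrightarrow> reduced y \<in> GF \<phi>"
  by (simp add: GF_iff reduced_extensional reduced_flow)

lemma minimal_iff_tight:
  assumes u: "u \<in> GF \<phi>"
  shows "u \<in> GF_min \<phi> \<longleftrightarrow> tight u"
proof
  assume "u \<in> GF_min \<phi>"
  then have "u = reduced u"
    using succeeds_reduced[OF GF_flow[OF u]] reduced_GF[OF u] by (simp add: GF_min_def)
  then show "tight u" using reduced_tight[OF GF_flow[OF u]] by simp
next
  assume "tight u"
  then have "u = v" if "v \<in> GF \<phi>" "u \<succ> v" for v
    using tight_minimal[OF GF_flow[OF u] _ GF_flow[OF that(1)] that(2)] u that(1)
    by (intro GF_eqI) auto
  then show "u \<in> GF_min \<phi>" using u by (simp add: GF_min_def)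
qed

lemma GF_minD: "u \<in> GF_min \<phi> \<Longrightarrow> u \<in> GF \<phi>" "u \<in> GF_min \<phi> \<Longrightarrow> flow u" "u \<in> GF_min \<phi> \<Longrightarrow> tight u"
  using minimal_iff_tight by (auto simp: GF_min_def GF_flow)

lemma reduced_minimal: "y \<in> GF \<phi> \<Longrightarrow> reduced y \<in> GF_min \<phi>"
  using minimal_iff_tight[OF reduced_GF] reduced_tight[OF GF_flow] by blast

lemma reduced_at_0: "y \<in> GF \<phi> \<Longrightarrow> reduced y 0 = y 0"
  using reduced_active_time[OF GF_flow, of y 0] active_time_0[OF GF_flow, of y] by simp

text \<open>
  Each of the two minimal solutions is a competitor for the other in the comparison of energies.
\<close>

lemma minimal_same_trace_unique:
  assumes y: "y \<in> GF \<phi>" and u: "u \<in> GF_min \<phi>" "Rg y \<subseteq> Rg u" "Rg u \<subseteq> closure (Rg y)"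
    and v: "v \<in> GF_min \<phi>" "Rg y \<subseteq> Rg v" "Rg v \<subseteq> closure (Rg y)"
  shows "u = v"
proof (rule GF_eqI)
  have "u 0 = v 0"
    using initial_value_of_enlarged_range[OF GF_flow[OF y] GF_minD(2)[OF u(1)] u(2,3)]
      initial_value_of_enlarged_range[OF GF_flow[OF y] GF_minD(2)[OF v(1)] v(2,3)] by simp
  moreover have "Rg u \<subseteq> closure (Rg v)" "Rg v \<subseteq> closure (Rg u)"
    using u v by (meson closure_mono order_trans)+
  ultimately show "u t = v t" if "0 \<le> t" for t
    using tight_same_trace_unique[of u v t] that GF_minD[OF u(1)] GF_minD[OF v(1)] by simp
qed (use u v GF_minD in auto)

lemma minimal_representative:
  assumes R: "R \<in> Rg ` GF \<phi>"
  shows "\<exists>!u. u \<in> GF_min \<phi> \<and> R \<subseteq> Rg u \<and> Rg u \<subseteq> closure R"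
    and "\<lbrakk>u \<in> GF_min \<phi>; R \<subseteq> Rg u; Rg u \<subseteq> closure R; v \<in> GF \<phi>; R \<subseteq> Rg v; Rg v \<subseteq> closure R\<rbrakk> \<Longrightarrow> v \<succ> u"
proof -
  obtain y where y: "y \<in> GF \<phi>" "R = Rg y" using R by blast
  show "\<exists>!u. u \<in> GF_min \<phi> \<and> R \<subseteq> Rg u \<and> Rg u \<subseteq> closure R"
    using reduced_minimal[OF y(1)] reduced_range[OF GF_flow[OF y(1)]] minimal_same_trace_unique[OF y(1)] y(2)
    by (intro ex_ex1I exI[of _ "reduced y"]) auto
  assume u: "u \<in> GF_min \<phi>" "R \<subseteq> Rg u" "Rg u \<subseteq> closure R"
    and v: "v \<in> GF \<phi>" "R \<subseteq> Rg v" "Rg v \<subseteq> closure R"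
  have r: "Rg v \<subseteq> Rg (reduced v)" "Rg (reduced v) \<subseteq> closure (Rg v)"
    using reduced_range[OF GF_flow[OF v(1)]] by auto
  have "closure (Rg v) \<subseteq> closure R" using v(3) by (simp add: closure_minimal)
  then have "u = reduced v"
    using r u v y reduced_minimal[OF v(1)] by (intro minimal_same_trace_unique[OF y(1)]) auto
  then show "v \<succ> u" using succeeds_reduced[OF GF_flow[OF v(1)]] by simp
qed

lemma minimal_below_unique:
  assumes v: "v \<in> GF \<phi>"
  shows "\<exists>!u. u \<in> GF_min \<phi> \<and> v \<succ> u"
proof (rule ex_ex1I)
  show "\<exists>u. u \<in> GF_min \<phi> \<and> v \<succ> u"
    using reduced_minimal[OF v] succeeds_reduced[OF GF_flow[OF v]] by blast
  have range: "Rg v \<subseteq> Rg u \<and> Rg u \<subseteq> closure (Rg v)" if "v \<succ> u" for u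
    using that unfolding succeeds_def Rg_def by fastforce
  fix u u' assume "u \<in> GF_min \<phi> \<and> v \<succ> u" "u' \<in> GF_min \<phi> \<and> v \<succ> u'"
  then show "u = u'" using range minimal_same_trace_unique[OF v, of u u'] by blast
qed

text \<open>
  For the converse, the competitor \<open>reduced u\<close> reaches \<open>u t\<close> at time \<open>active_time u t\<close>.
\<close>

lemma minimal_iff_earliest_arrival:
  assumes u: "u \<in> GF \<phi>"
  shows "u \<in> GF_min \<phi> \<longleftrightarrow>
    (\<forall>v \<in> TGF \<phi>. v 0 = u 0 \<and> Rg v \<subseteq> closure (Rg u) \<longrightarrow>
       (\<forall>t0\<ge>0. \<forall>t1\<ge>0. u t0 = v t1 \<longrightarrow> min (ereal t0) (T_star u) \<le> ereal t1))" (is "_ \<longleftrightarrow> ?P")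
proof
  assume "u \<in> GF_min \<phi>"
  then have tight: "tight u" by (rule GF_minD)
  show ?P
  proof (intro ballI impI allI, elim conjE)
    fix v t0 t1 assume v: "v \<in> TGF \<phi>" "v 0 = u 0" "Rg v \<subseteq> closure (Rg u)"
      and t: "0 \<le> t0" "0 \<le> t1" "u t0 = v t1"
    obtain w b where w: "flow w" "w 0 = v 0" "0 \<le> b" "b \<le> t1" "w b = v t1" "w ` {0..b} \<subseteq> Rg v"
      by (rule TGF_prefix[OF v(1) t(2)])
    have "min (ereal t0) (T_star u) \<le> ereal b"
      by (rule tight_arrival_time[OF GF_flow[OF u] tight w(1) _ w(3) _ t(1)]) (use v w t in auto)
    then show "min (ereal t0) (T_star u) \<le> ereal t1" using w(4) by (meson ereal_less_eq(3) order_trans)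
  qed
next
  assume P: ?P
  have fl: "flow u" by (rule GF_flow[OF u])
  have "tight u" unfolding tight_def
  proof (intro allI impI)
    fix t assume t: "0 \<le> t" "ereal t < T_star u"
    have "reduced u \<in> TGF \<phi>" using reduced_GF[OF u] by (simp add: TGF_def)
    then have "\<forall>t0\<ge>0. \<forall>t1\<ge>0. u t0 = reduced u t1 \<longrightarrow> min (ereal t0) (T_star u) \<le> ereal t1"
      using P reduced_at_0[OF u] reduced_range[OF fl] by blast
    then have "min (ereal t) (T_star u) \<le> ereal (active_time u t)"
      using t(1) active_time_bounds[OF fl t(1)] reduced_active_time[OF fl t(1)] by metis
    then have "t \<le> active_time u t" using t(2) by (simp add: min_def split: if_splits)
    then show "active_time u t = t" using active_time_bounds[OF fl t(1)] by simp
  qed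
  then show "u \<in> GF_min \<phi>" using minimal_iff_tight[OF u] by simp
qed

lemma minimal_energy_least:
  assumes u: "u \<in> GF_min \<phi>" and v: "v \<in> TGF \<phi>" "v 0 = u 0" "Rg v \<subseteq> closure (Rg u)" and t: "0 \<le> t"
  shows "\<phi> (u t) \<le> \<phi> (v t)"
proof -
  obtain w b where w: "flow w" "w 0 = v 0" "0 \<le> b" "b \<le> t" "w b = v t" "w ` {0..b} \<subseteq> Rg v"
    by (rule TGF_prefix[OF v(1) t])
  have "\<phi> (u t) \<le> \<phi> (u b)" by (rule energy_antimono[OF GF_minD(2)[OF u] w(3,4)])
  also have "\<dots> \<le> \<phi> (w b)"
    by (rule tight_energy_least[OF GF_minD(2)[OF u] GF_minD(3)[OF u] w(1) _ w(3)]) (use v w in auto)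
  finally show ?thesis using w by simp
qed

text \<open>
  For the converse, compare \<open>u\<close> with \<open>reduced u\<close> at time \<open>active_time u t\<close>: the latter is at
  \<open>u t\<close>, so \<open>u\<close> has already lost all the energy that it loses until \<open>t\<close>.
\<close>

lemma minimal_iff_energy_least:
  assumes u: "u \<in> GF \<phi>"
  shows "u \<in> GF_min \<phi> \<longleftrightarrow>
    (\<forall>v \<in> TGF \<phi>. v 0 = u 0 \<and> Rg v \<subseteq> closure (Rg u) \<longrightarrow> (\<forall>t\<ge>0. \<phi> (v t) \<ge> \<phi> (u t)))"
    (is "_ \<longleftrightarrow> ?P")
proof
  assume "u \<in> GF_min \<phi>"
  then show ?P using minimal_energy_least by blast
next
  assume P: ?P
  have fl: "flow u" by (rule GF_flow[OF u])
  have "tight u"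
  proof (rule tightI[OF fl])
    fix t :: real assume t: "0 \<le> t"
    note b = active_time_bounds[OF fl t]
    have "reduced u \<in> TGF \<phi>" using reduced_GF[OF u] by (simp add: TGF_def)
    then have "\<phi> (u (active_time u t)) \<le> \<phi> (reduced u (active_time u t))"
      using P reduced_at_0[OF u] reduced_range[OF fl] b(1) by blast
    then have "\<phi> (u (active_time u t)) \<le> \<phi> (u t)" by (simp add: reduced_active_time[OF fl t])
    from eq_if_energy_ge[OF fl b this] show "u (active_time u t) = u t" by simp
  qed
  then show "u \<in> GF_min \<phi>" using minimal_iff_tight[OF u] by simp
qed

lemma minimal_determined_by_energy:
  assumes u: "u \<in> GF_min \<phi>" and v: "v \<in> TGF \<phi>" "v 0 = u 0" "Rg v \<subseteq> Rg u"
    and t: "0 \<le> t" "\<phi> (v t) \<le> \<phi> (u t)"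
  shows "v t = u t"
proof -
  have sub: "Rg v \<subseteq> closure (Rg u)" using v(3) closure_subset by blast
  then have "\<phi> (v t) = \<phi> (u t)" using minimal_energy_least[OF u v(1,2) sub t(1)] t(2) by simp
  moreover have "v t \<in> closure (Rg u)" using sub t(1) by (auto simp: Rg_def)
  ultimately show ?thesis using closure_range_eq[OF GF_minD(2)[OF u] _ t(1)] by simp
qed

lemma minimal_iff_inverse_loc_abs_cont:
  assumes u: "u \<in> GF \<phi>"
  shows "u \<in> GF_min \<phi> \<longleftrightarrow> (\<exists>\<psi>. \<psi> \<in> levels u \<rightarrow> lifetime u \<and> loc_abs_cont_on (levels u) \<psi> \<and>
    (\<forall>t. 0 \<le> t \<and> ereal t < T_star u \<longrightarrow> t = \<psi> (\<phi> (u t))))" (is "_ \<longleftrightarrow> ?P")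
proof
  assume "u \<in> GF_min \<phi>"
  then obtain \<psi> where "\<psi> \<in> levels u \<rightarrow> lifetime u" "loc_abs_cont_on (levels u) \<psi>"
    "\<And>t. t \<in> lifetime u \<Longrightarrow> \<psi> (\<phi> (u t)) = t"
    using tight_inverse_loc_abs_cont GF_minD by metis
  then show ?P by (intro exI[of _ \<psi>]) (simp add: lifetime_def)
next
  assume ?P
  then obtain \<psi> where "loc_abs_cont_on (levels u) \<psi>" "\<And>t. t \<in> lifetime u \<Longrightarrow> \<psi> (\<phi> (u t)) = t"
    by (auto simp: lifetime_def)
  then have "tight u" by (rule tight_if_inverse_loc_abs_cont[OF GF_flow[OF u]])
  then show "u \<in> GF_min \<phi>" using minimal_iff_tight[OF u] by simp
qed

end

section \<open>Characterisation of minimal solutions\<close>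

theorem theorem3p5:
  fixes \<phi> :: "'a::{real_inner, complete_space} \<Rightarrow> real"
    and \<tau> c :: real
  assumes "C1_functional \<phi>"
    and "\<tau> > 0"
    and "\<And>x. 1 / (2 * \<tau>) * (norm x)\<^sup>2 + \<phi> x \<ge> - c"
  shows
    "(\<comment> \<open>(1)\<close>
      (\<forall>R \<in> Rg ` GF \<phi>.
         (\<exists>!u. u \<in> GF_min \<phi> \<and> R \<subseteq> Rg u \<and> Rg u \<subseteq> closure R) \<and>
         (\<forall>u \<in> GF_min \<phi>. R \<subseteq> Rg u \<and> Rg u \<subseteq> closure R \<longrightarrow>
            (\<forall>v \<in> GF \<phi>. R \<subseteq> Rg v \<and> Rg v \<subseteq> closure R \<longrightarrow> v \<succ> u))) \<and>
      (\<forall>v \<in> GF \<phi>. \<exists>!u. u \<in> GF_min \<phi> \<and> v \<succ> u))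
   \<and> (\<comment> \<open>(2)\<close>
      \<forall>u \<in> GF \<phi>. u \<in> GF_min \<phi> \<longleftrightarrow>
        (\<forall>v \<in> TGF \<phi>. v 0 = u 0 \<and> Rg v \<subseteq> closure (Rg u) \<longrightarrow>
           (\<forall>t0\<ge>0. \<forall>t1\<ge>0. u t0 = v t1 \<longrightarrow> min (ereal t0) (T_star u) \<le> ereal t1)))
   \<and> (\<comment> \<open>(3)\<close>
      \<forall>u \<in> GF \<phi>. u \<in> GF_min \<phi> \<longleftrightarrow>
        (\<forall>v \<in> TGF \<phi>. v 0 = u 0 \<and> Rg v \<subseteq> closure (Rg u) \<longrightarrow>
           (\<forall>t\<ge>0. \<phi> (v t) \<ge> \<phi> (u t))))
   \<and> (\<comment> \<open>(4)\<close>
      \<forall>u \<in> GF_min \<phi>. \<forall>v \<in> TGF \<phi>.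
        v 0 = u 0 \<and> Rg v \<subseteq> Rg u \<and>
        (\<forall>t. 0 \<le> t \<and> ereal t < T_star v \<longrightarrow> \<phi> (v t) \<le> \<phi> (u t)) \<longrightarrow>
        (\<forall>t. 0 \<le> t \<and> ereal t < T_star v \<longrightarrow> v t = u t))
   \<and> (\<comment> \<open>(5)\<close>
      (\<forall>u \<in> GF \<phi>. u \<in> GF_min \<phi> \<longleftrightarrow>
         emeasure lebesgue {t. 0 \<le> t \<and> ereal t < T_star u \<and> grad \<phi> (u t) = 0} = 0) \<and>
      (\<forall>u \<in> GF_min \<phi>. T_star u > 0 \<longrightarrow>
         strict_antimono_on {t. 0 \<le> t \<and> ereal t < T_star u} (\<lambda>t. \<phi> (u t)) \<and>
         inj_on u {t. 0 \<le> t \<and> ereal t < T_star u}))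
   \<and> (\<comment> \<open>(6)\<close>
      \<forall>u \<in> GF \<phi>. \<not> u constant_on {0..} \<longrightarrow>
        (u \<in> GF_min \<phi> \<longleftrightarrow>
          (\<exists>\<psi>. \<psi> \<in> {r. (INF x\<in>Rg u. ereal (\<phi> x)) < ereal r \<and> r \<le> \<phi> (u 0)} \<rightarrow>
                     {t. 0 \<le> t \<and> ereal t < T_star u} \<and>
               loc_abs_cont_on {r. (INF x\<in>Rg u. ereal (\<phi> x)) < ereal r \<and> r \<le> \<phi> (u 0)} \<psi> \<and>
               (\<forall>t. 0 \<le> t \<and> ereal t < T_star u \<longrightarrow> t = \<psi> (\<phi> (u t))))))"
proof -
  interpret bounded_energy \<phi> "grad \<phi>" \<tau> c
    by unfold_locales (use C1_functional_grad[OF assms(1)] assms(2,3) in auto)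
  have part1: "(\<exists>!u. u \<in> GF_min \<phi> \<and> R \<subseteq> Rg u \<and> Rg u \<subseteq> closure R) \<and>
      (\<forall>u \<in> GF_min \<phi>. R \<subseteq> Rg u \<and> Rg u \<subseteq> closure R \<longrightarrow>
        (\<forall>v \<in> GF \<phi>. R \<subseteq> Rg v \<and> Rg v \<subseteq> closure R \<longrightarrow> v \<succ> u))" if "R \<in> Rg ` GF \<phi>" for R
    using minimal_representative[OF that] by blast
  have part5: "u \<in> GF_min \<phi> \<longleftrightarrow>
      emeasure lebesgue {t. 0 \<le> t \<and> ereal t < T_star u \<and> grad \<phi> (u t) = 0} = 0" if "u \<in> GF \<phi>" for u
    using minimal_iff_tight[OF that] tight_iff_critical_set_null[OF GF_flow[OF that]] by simp
  have strict: "strict_antimono_on {t. 0 \<le> t \<and> ereal t < T_star u} (\<lambda>t. \<phi> (u t)) \<and>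
      inj_on u {t. 0 \<le> t \<and> ereal t < T_star u}" if u: "u \<in> GF_min \<phi>" for u
  proof
    show "strict_antimono_on {t. 0 \<le> t \<and> ereal t < T_star u} (\<lambda>t. \<phi> (u t))"
      using tight_energy_strict[OF GF_minD(2)[OF u] GF_minD(3)[OF u]] by (intro monotone_onI) auto
    show "inj_on u {t. 0 \<le> t \<and> ereal t < T_star u}"
      using tight_injective[OF GF_minD(2)[OF u] GF_minD(3)[OF u]] by (intro inj_onI) auto
  qed
  have part4: "\<forall>t. 0 \<le> t \<and> ereal t < T_star v \<longrightarrow> v t = u t"
    if "u \<in> GF_min \<phi>" "v \<in> TGF \<phi>" "v 0 = u 0 \<and> Rg v \<subseteq> Rg u \<and>
      (\<forall>t. 0 \<le> t \<and> ereal t < T_star v \<longrightarrow> \<phi> (v t) \<le> \<phi> (u t))" for u v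
    using minimal_determined_by_energy[OF that(1,2)] that(3) by blast
  show ?thesis
  proof (intro conjI, goal_cases)
    case 1 show ?case by (intro ballI part1)
  next
    case 2 show ?case using minimal_below_unique by blast
  next
    case 3 show ?case by (intro ballI minimal_iff_earliest_arrival)
  next
    case 4 show ?case by (intro ballI minimal_iff_energy_least)
  next
    case 5 show ?case using part4 by blast
  next
    case 6 show ?case by (intro ballI part5)
  next
    case 7 show ?case using strict by blast
  next
    case 8 show ?case
      by (intro ballI impI minimal_iff_inverse_loc_abs_cont[unfolded levels_def lifetime_def])
  qed
qed

end
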